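(* Let $R$ be a $d\times d$ expansive integer matrix, let $B\subset\mathbb{Z}^d$ with $\#B=N\ge 2$, let $\tau_b(x)=R^{-1}(x+b)$ for $b\in B$, and let $\mu=\mu_B$ be the invariant measure of the iterated function system $(\tau_b)_{b\in B}$. Assume that $\mu$ has no overlap. Let $\Lambda$ be a discrete subset of $\mathbb{R}^d$. For $r_0>0$ and $n\in\mathbb{N}$ put $$\Lambda_n(r_0):=\{\lambda\in\Lambda: |(R^T)^{-n}\lambda|\le r_0\}$$ and consider the matrix $$A_n(r_0):=\frac{1}{\sqrt{N^n}}\left(e^{-2\pi i\lambda\cdot\tau_k(0)}\right)_{\lambda\in\Lambda_n(r_0),\,k\in B^n}.$$ Then the following assertions are equivalent: (i) The set $\Lambda$ is a Bessel spectrum for $\mu$. (ii) There exist $r_0>0$ and $C>0$ such that for all $n\in\mathbb{N}$ the norm of the matrix $A_n(r_0)$ is bounded by $C$. (iii) For all $r_0>0$ there exists $C(r_0)>0$ such that for all $n\in\mathbb{N}$ the norm of the matrix $A_n(r_0)$ is bounded by $C(r_0)$.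
   Context: A matrix is expansive if all its eigenvalues have modulus greater than $1$. $\mu_B$ is the unique Borel probability measure on $\mathbb{R}^d$ with $\int f\,d\mu_B=\frac1N\sum_{b\in B}\int f\circ\tau_b\,d\mu_B$ for all continuous functions $f$ on $\mathbb R^d$. $X_B$ is the attractor of the IFS, i.e. the unique nonempty compact set with $X_B=\bigcup_{b\in B}\tau_b(X_B)$. The measure $\mu_B$ has no overlap if $\mu_B(\tau_b(X_B)\cap\tau_{b'}(X_B))=0$ for all $b\ne b'$ in $B$. For $k=(k_1,\dots,k_n)\in B^n$, $\tau_k:=\tau_{k_n}\circ\dots\circ\tau_{k_1}$. $|\cdot|$ is the Euclidean norm. The norm of a matrix indexed by $\Lambda_n(r_0)\times B^n$ is its operator norm from $\mathbb{C}^{B^n}$ to $\ell^2(\Lambda_n(r_0))$ (with $\ell^2$ norms). With $e_\lambda(x)=e^{2\pi i\lambda\cdot x}$, a set $\Lambda\subset\mathbb{R}^d$ is a Bessel spectrum for $\mu$ if $(e_\lambda)_{\lambda\in\Lambda}$ is a Bessel sequence in $L^2(\mu)$: there is $M>0$ with $\sum_{\lambda\in\Lambda}|\langle v,e_\lambda\rangle|^2\le M\|v\|^2$ for all $v\in L^2(\mu)$. *)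

theory Defs
  imports "HOL-Probability.Probability"
begin

definition integer_matrix :: "real ^ 'd ^ 'd \<Rightarrow> bool" where
  "integer_matrix R \<longleftrightarrow> (\<forall>i j. R $ i $ j \<in> \<int>)"

definition integer_vector :: "real ^ 'd \<Rightarrow> bool" where
  "integer_vector b \<longleftrightarrow> (\<forall>i. b $ i \<in> \<int>)"

definition complex_eigenvalue :: "real ^ 'd ^ 'd \<Rightarrow> complex \<Rightarrow> bool" where
  "complex_eigenvalue R z \<longleftrightarrow>
     (\<exists>v :: complex ^ 'd. v \<noteq> 0 \<and> (\<chi> i j. complex_of_real (R $ i $ j)) *v v = z *s v)"

definition expansive :: "real ^ 'd ^ 'd \<Rightarrow> bool" where
  "expansive R \<longleftrightarrow> (\<forall>z. complex_eigenvalue R z \<longrightarrow> 1 < cmod z)"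

definition tau :: "real ^ 'd ^ 'd \<Rightarrow> real ^ 'd \<Rightarrow> real ^ 'd \<Rightarrow> real ^ 'd" where
  "tau R b x = matrix_inv R *v (x + b)"

text \<open>
  The invariant measure has compact support, so every continuous function is integrable
  against it and the unbounded test functions cause no trouble with the convention that the
  integral of a non-integrable function is 0.  The property below determines the measure
  uniquely when \<open>R\<close> is expansive and \<open>B\<close> is finite and nonempty.
\<close>
definition invariant_measure :: "real ^ 'd ^ 'd \<Rightarrow> (real ^ 'd) set \<Rightarrow> (real ^ 'd) measure \<Rightarrow> bool" where
  "invariant_measure R B M \<longleftrightarrow>
     prob_space M \<and> sets M = sets borel \<and>
     (\<forall>f :: real ^ 'd \<Rightarrow> complex. continuous_on UNIV f \<longrightarrow>
        (LINT x|M. f x) = 1 / of_nat (card B) * (\<Sum>b\<in>B. LINT x|M. f (tau R b x)))"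

definition attractor :: "real ^ 'd ^ 'd \<Rightarrow> (real ^ 'd) set \<Rightarrow> (real ^ 'd) set \<Rightarrow> bool" where
  "attractor R B X \<longleftrightarrow> X \<noteq> {} \<and> compact X \<and> X = (\<Union>b\<in>B. tau R b ` X)"

definition no_overlap ::
    "real ^ 'd ^ 'd \<Rightarrow> (real ^ 'd) set \<Rightarrow> (real ^ 'd) set \<Rightarrow> (real ^ 'd) measure \<Rightarrow> bool" where
  "no_overlap R B X M \<longleftrightarrow>
     (\<forall>b\<in>B. \<forall>b'\<in>B. b \<noteq> b' \<longrightarrow> emeasure M (tau R b ` X \<inter> tau R b' ` X) = 0)"

definition words :: "'a set \<Rightarrow> nat \<Rightarrow> 'a list set" where
  "words B n = {k. set k \<subseteq> B \<and> length k = n}"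

text \<open>
  \<open>fold\<close> applies the map of the first letter first, so
  \<open>tau_word R [k1, ..., kn] = tau R kn \<circ> ... \<circ> tau R k1\<close>.
\<close>
definition tau_word :: "real ^ 'd ^ 'd \<Rightarrow> (real ^ 'd) list \<Rightarrow> real ^ 'd \<Rightarrow> real ^ 'd" where
  "tau_word R k = fold (tau R) k"

definition e_fun :: "real ^ 'd \<Rightarrow> real ^ 'd \<Rightarrow> complex" where
  "e_fun l x = exp (2 * of_real pi * \<i> * of_real (l \<bullet> x))"

definition square_integrable :: "'a measure \<Rightarrow> ('a \<Rightarrow> complex) \<Rightarrow> bool" where
  "square_integrable M v \<longleftrightarrow> v \<in> borel_measurable M \<and> integrable M (\<lambda>x. (cmod (v x))\<^sup>2)"

definition L2_inner :: "'a measure \<Rightarrow> ('a \<Rightarrow> complex) \<Rightarrow> ('a \<Rightarrow> complex) \<Rightarrow> complex" where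
  "L2_inner M v w = (LINT x|M. v x * cnj (w x))"

definition L2_norm :: "'a measure \<Rightarrow> ('a \<Rightarrow> complex) \<Rightarrow> real" where
  "L2_norm M v = sqrt (LINT x|M. (cmod (v x))\<^sup>2)"

text \<open>
  Summability is required explicitly because \<open>infsum\<close> is 0 for divergent families.
\<close>
definition Bessel_sequence :: "'a measure \<Rightarrow> 'i set \<Rightarrow> ('i \<Rightarrow> 'a \<Rightarrow> complex) \<Rightarrow> bool" where
  "Bessel_sequence M I f \<longleftrightarrow>
     (\<exists>K>0. \<forall>v. square_integrable M v \<longrightarrow>
        (\<lambda>i. (cmod (L2_inner M v (f i)))\<^sup>2) summable_on I \<and>
        (\<Sum>\<^sub>\<infinity>i\<in>I. (cmod (L2_inner M v (f i)))\<^sup>2) \<le> K * (L2_norm M v)\<^sup>2)"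

definition Bessel_spectrum :: "(real ^ 'd) measure \<Rightarrow> (real ^ 'd) set \<Rightarrow> bool" where
  "Bessel_spectrum M L \<longleftrightarrow> Bessel_sequence M L e_fun"

text \<open>
  The index set of the rows may be infinite, so the norms below take values in \<open>ennreal\<close>:
  \<open>ell2_norm I x = \<infinity>\<close> iff \<open>x\<close> is not in \<open>\<ell>\<^sup>2(I)\<close>, and \<open>matrix_norm I J A = \<infinity>\<close> iff \<open>A\<close> is not
  a bounded operator from \<open>\<complex>\<^sup>J\<close> to \<open>\<ell>\<^sup>2(I)\<close>.  The index set \<open>J\<close> of the columns is meant to be
  finite.
\<close>
definition ell2_norm :: "'i set \<Rightarrow> ('i \<Rightarrow> complex) \<Rightarrow> ennreal" where
  "ell2_norm I x =
     (if (\<lambda>i. (cmod (x i))\<^sup>2) summable_on I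
      then ennreal (sqrt (\<Sum>\<^sub>\<infinity>i\<in>I. (cmod (x i))\<^sup>2)) else \<infinity>)"

definition matrix_norm :: "'i set \<Rightarrow> 'j set \<Rightarrow> ('i \<Rightarrow> 'j \<Rightarrow> complex) \<Rightarrow> ennreal" where
  "matrix_norm I J A =
     (SUP a \<in> {a. ell2_norm J a \<le> 1}. ell2_norm I (\<lambda>i. \<Sum>j\<in>J. A i j * a j))"

definition Lambda_n :: "real ^ 'd ^ 'd \<Rightarrow> (real ^ 'd) set \<Rightarrow> nat \<Rightarrow> real \<Rightarrow> (real ^ 'd) set" where
  "Lambda_n R L n r = {l \<in> L. norm ((((*v) (matrix_inv (transpose R))) ^^ n) l) \<le> r}"

definition A_entry ::
    "real ^ 'd ^ 'd \<Rightarrow> nat \<Rightarrow> nat \<Rightarrow> real ^ 'd \<Rightarrow> (real ^ 'd) list \<Rightarrow> complex" where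
  "A_entry R N n l k =
     1 / of_real (sqrt (real N ^ n)) * exp (- 2 * of_real pi * \<i> * of_real (l \<bullet> tau_word R k 0))"

definition A_norm ::
    "real ^ 'd ^ 'd \<Rightarrow> (real ^ 'd) set \<Rightarrow> (real ^ 'd) set \<Rightarrow> nat \<Rightarrow> real \<Rightarrow> ennreal" where
  "A_norm R B L n r = matrix_norm (Lambda_n R L n r) (words B n) (A_entry R (card B) n)"

end

theory Submission
  imports Defs "HOL-Computational_Algebra.Fundamental_Theorem_Algebra"
begin

text \<open>
  Write \<open>N = card B\<close> and \<open>S\<close> for the transpose of \<open>R\<close>.  Iterating the invariance of \<open>M\<close> gives, for
  every \<open>n\<close>, that the integral of \<open>f\<close> is the mean over the words \<open>k\<close> of length \<open>n\<close> of the integrals of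
  \<open>f \<circ> tau_word R k\<close>, for bounded Borel functions \<open>f\<close> (lemma \<open>integral_tau_word\<close>).  The map of a word
  is \<open>x \<mapsto> q x + tau_word R k 0\<close> with \<open>q\<close> the \<open>n\<close>-th power of the inverse of \<open>R\<close>, so an
  exponential \<open>e_fun l\<close> composed with it is an entry of \<open>A_n\<close>, conjugated and rescaled, times a
  factor of modulus 1 that does not depend on \<open>k\<close>.

  Bounded matrices give a Bessel spectrum.  Let \<open>F\<close> be a finite subset of \<open>L\<close>.  Because
  \<open>R\<close> is expansive, the powers of the inverse of \<open>S\<close> tend to 0 and \<open>F\<close> lies in \<open>Lambda_n R L n r0\<close>
  for some \<open>n\<close>.  The previous remark expresses the squared norm of \<open>\<Sum>l\<in>F. c l * e_fun l\<close> as an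
  average over \<open>x\<close> of squared norms of the adjoint of \<open>A_n\<close>, evaluated at \<open>c\<close> up to factors of
  modulus 1; hence it is at most \<open>C\<^sup>2\<close> times the squared norm of \<open>c\<close> (lemma \<open>synthesis_bound\<close>).
  By duality this is the Bessel inequality on \<open>F\<close>, with a constant that does not depend on \<open>F\<close>
  (lemma \<open>analysis_bound_if_synthesis_bound\<close>).

  A Bessel spectrum gives bounded matrices.  The measure lives on the attractor \<open>X\<close>, and
  without overlap almost every point of the cylinder \<open>tau_word R k ` X\<close> lies in no other cylinder of the same
  level.  For coefficients \<open>a\<close> and a frequency \<open>u\<close> let \<open>v\<close> be the function that is \<open>a k\<close> times a normalized
  exponential of frequency \<open>u\<close> on the cylinder of \<open>k\<close>.  Its squared norm is \<open>\<Sum>k. \<bar>a k\<bar>\<^sup>2\<close> divided by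
  \<open>N ^ n\<close>, and its inner product with \<open>e_fun l\<close> is the entry at \<open>l\<close> of \<open>A_n a\<close>, divided by \<open>sqrt (N ^ n)\<close>, times
  the Fourier transform of \<open>M\<close> at the \<open>n\<close>-th power of the inverse of \<open>S\<close> applied to \<open>l - u\<close>
  (lemma \<open>inner_cylinder_wave\<close>).  The Fourier transform is at least \<open>1 / 2\<close> in modulus near 0, so the
  Bessel inequality for \<open>v\<close> bounds the rows whose rescaled frequency is close to that of \<open>u\<close>.
  Finitely many choices of \<open>u\<close> cover all rows, for any radius.
\<close>

section \<open>Powers of matrices with spectrum in the unit disc\<close>
text \<open>
  After a finite time the perturbation stays below \<open>(1 - q) * r / 2\<close>, so it contributes
  at most the fixed point \<open>r / 2\<close> of the recursion, while the initial value decays geometrically.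
\<close>
lemma contracting_recursion_tendsto_zero:
  fixes a :: "nat \<Rightarrow> 'a::real_normed_vector" and e :: "nat \<Rightarrow> real"
  assumes step: "\<And>n. norm (a (Suc n)) \<le> q * norm (a n) + e n"
    and q: "0 \<le> q" "q < 1" and e: "e \<longlonglongrightarrow> 0"
  shows "a \<longlonglongrightarrow> 0"
proof (rule LIMSEQ_I)
  fix r :: real assume r: "0 < r"
  define d where "d = r / 2 * (1 - q)"
  have "d > 0" using r q by (simp add: d_def)
  then obtain n0 where n0: "\<And>n. n \<ge> n0 \<Longrightarrow> \<bar>e n\<bar> < d"
    using LIMSEQ_D[OF e, of d] by auto
  have bound: "norm (a (n0 + k)) \<le> q ^ k * norm (a n0) + r / 2" for k
  proof (induction k)
    case 0
    then show ?case using r by simp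
  next
    case (Suc k)
    have "norm (a (n0 + Suc k)) \<le> q * norm (a (n0 + k)) + d"
      using step[of "n0 + k"] n0[of "n0 + k"] by simp
    also have "\<dots> \<le> q * (q ^ k * norm (a n0) + r / 2) + d"
      using Suc q by (intro add_right_mono mult_left_mono) auto
    also have "\<dots> = q ^ Suc k * norm (a n0) + r / 2"
      by (simp add: d_def field_simps)
    finally show ?case .
  qed
  have "(\<lambda>k. q ^ k * norm (a n0)) \<longlonglongrightarrow> 0"
    using q by (intro tendsto_mult_left_zero LIMSEQ_realpow_zero) auto
  then obtain k0 where k0: "\<And>k. k \<ge> k0 \<Longrightarrow> \<bar>q ^ k * norm (a n0)\<bar> < r / 2"
    using LIMSEQ_D[of _ 0 "r/2"] r by fastforce
  have "norm (a n - 0) < r" if "n \<ge> n0 + k0" for n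
  proof -
    from that obtain k where "n = n0 + k" "k \<ge> k0"
      by (metis add.commute add_le_cancel_left le_Suc_ex le_add1 order_trans)
    then show ?thesis using bound[of k] k0[of k] by simp
  qed
  then show "\<exists>no. \<forall>n\<ge>no. norm (a n - 0) < r" by blast
qed

text \<open>
  This is \<open>p(A) v\<close>, computed by Horner's rule.  The action on vectors avoids a ring of
  matrices: the multiplication of the type \<open>complex ^ 'n ^ 'n\<close> is entrywise.
\<close>
definition poly_act :: "complex ^ 'n ^ 'n \<Rightarrow> complex poly \<Rightarrow> complex ^ 'n \<Rightarrow> complex ^ 'n" where
  "poly_act A p v = fold_coeffs (\<lambda>c w. c *s v + A *v w) p 0"

lemma poly_act_0 [simp]: "poly_act A 0 v = 0"
  by (simp add: poly_act_def)

lemma poly_act_pCons [simp]: "poly_act A (pCons c p) v = c *s v + A *v poly_act A p v"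
  by (cases "c = 0"; cases "p = 0") (simp_all add: poly_act_def)

lemma poly_act_add: "poly_act A (p + q) v = poly_act A p v + poly_act A q v"
  by (induction p q rule: poly_induct2)
     (simp_all add: matrix_vector_right_distrib vec.scale_left_distrib)

lemma poly_act_smult: "poly_act A (smult c p) v = c *s poly_act A p v"
  by (induction p)
     (simp_all add: vec.scale_right_distrib vec.scale)

lemma poly_act_monom: "poly_act A (monom c i) v = c *s (((*v) A ^^ i) v)"
  by (induction i) (simp_all add: monom_0 monom_Suc vec.scale)

lemma poly_act_commute: "poly_act A p (A *v v) = A *v poly_act A p v"
  by (induction p) (simp_all add: matrix_vector_right_distrib vec.scale)

lemma poly_act_diff: "poly_act A p (v - w) = poly_act A p v - poly_act A p w"
proof (induction p)
  case (pCons c p)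
  have "A *v (poly_act A p v - poly_act A p w) = A *v poly_act A p v - A *v poly_act A p w"
    by (rule vec.diff)
  then show ?case by (simp only: poly_act_pCons pCons.IH vec.scale_right_diff_distrib) simp
qed simp

lemma poly_act_scale: "poly_act A p (c *s v) = c *s poly_act A p v"
  by (induction p) (simp_all add: vec.scale vec.scale_right_distrib vec.scale_left_commute)

lemma poly_act_sum: "poly_act A (\<Sum>i\<in>I. p i) v = (\<Sum>i\<in>I. poly_act A (p i) v)"
  by (induction I rule: infinite_finite_induct) (simp_all add: poly_act_add)

lemma poly_act_linear_factor:
  "poly_act A ([:- z, 1:] * q) v = A *v poly_act A q v - z *s poly_act A q v"
proof -
  have "[:- z, 1:] * q = smult (- z) q + pCons 0 q" by simp
  then show ?thesis by (simp only: poly_act_add poly_act_smult poly_act_pCons) simp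
qed

text \<open>
  The vectors \<open>v\<close>, \<open>A v\<close>, \<open>A\<^sup>2 v\<close>, ... cannot be linearly independent in finite dimension.
  The case of a repeated vector is separate because dependence speaks of sets of vectors, which
  do not see repetitions.
\<close>
lemma annihilating_poly_exists:
  fixes A :: "complex ^ 'n ^ 'n"
  shows "\<exists>p. p \<noteq> 0 \<and> poly_act A p v = 0"
proof -
  define D where "D = vec.dim (UNIV :: (complex ^ 'n) set)"
  define w where "w i = ((*v) A ^^ i) v" for i
  show ?thesis
  proof (cases "inj_on w {..D}")
    case True
    have "vec.dependent (w ` {..D})"
    proof (rule ccontr)
      assume "\<not> vec.dependent (w ` {..D})"
      then have "card (w ` {..D}) \<le> D"
        unfolding D_def by (intro vec.independent_card_le_dim) auto
      then show False using card_image[OF True] by simp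
    qed
    then obtain u where u: "\<exists>x\<in>w ` {..D}. u x \<noteq> 0" "(\<Sum>x\<in>w ` {..D}. u x *s x) = 0"
      by (auto simp: vec.dependent_finite)
    define p where "p = (\<Sum>i\<le>D. monom (u (w i)) i)"
    have "poly_act A p v = (\<Sum>i\<le>D. u (w i) *s w i)"
      by (simp add: p_def poly_act_sum poly_act_monom w_def)
    also have "\<dots> = 0" using u(2) by (simp add: sum.reindex[OF True])
    finally have "poly_act A p v = 0" .
    moreover obtain j where j: "j \<le> D" "u (w j) \<noteq> 0" using u(1) by auto
    have "coeff p j = u (w j)" using j(1) by (simp add: p_def coeff_sum)
    ultimately show ?thesis using j(2) by (intro exI[of _ p]) auto
  next
    case False
    then obtain i j where ij: "i \<noteq> j" "w i = w j" by (auto simp: inj_on_def)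
    define p :: "complex poly" where "p = monom 1 i + monom (-1) j"
    have "poly_act A p v = 0"
      using ij(2) by (simp add: p_def poly_act_add poly_act_monom w_def)
    moreover have "coeff p i = 1" using ij(1) by (simp add: p_def)
    ultimately show ?thesis by (intro exI[of _ p]) auto
  qed
qed

lemma norm_vector_scalar_mult: "norm (c *s v) = cmod c * norm (v :: complex ^ 'n)"
  by (simp add: norm_vec_def L2_set_right_distrib norm_mult)

text \<open>
  Induction on the degree of a polynomial \<open>p\<close> with \<open>p(A) v = 0\<close>.  Split off a root,
  \<open>p = (X - z) q\<close>.  If \<open>q(A) v = 0\<close>, the degree has dropped.  Otherwise \<open>q(A) v\<close> is an
  eigenvector for \<open>z\<close>, so \<open>\<bar>z\<bar> < 1\<close>; moreover \<open>u = A v - z v\<close> is annihilated by \<open>q(A)\<close>, hence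
  \<open>A\<^sup>n u\<close> tends to 0, and \<open>A\<^sup>n v\<close> satisfies a contracting recursion with this perturbation.
\<close>
lemma matrix_powers_tendsto_zero:
  fixes A :: "complex ^ 'n ^ 'n"
  assumes eig: "\<And>z w. w \<noteq> 0 \<Longrightarrow> A *v w = z *s w \<Longrightarrow> cmod z < 1"
  shows "(\<lambda>n. ((*v) A ^^ n) v) \<longlonglongrightarrow> 0"
proof -
  have "(\<lambda>n. ((*v) A ^^ n) v) \<longlonglongrightarrow> 0" if "p \<noteq> 0" "poly_act A p v = 0" for p v
    using that
  proof (induction "degree p" arbitrary: p v)
    case 0
    then obtain c where "p = [:c:]" "c \<noteq> 0" by (metis degree_eq_zeroE pCons_0_0)
    then have v: "v = 0" using 0 by simp
    have "((*v) A ^^ n) v = 0" for n by (induction n) (simp_all add: v)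
    then show ?case by simp
  next
    case (Suc k)
    have "\<not> constant (poly p)" using Suc.hyps(2) by (simp add: constant_degree)
    then obtain z where "poly p z = 0" using fundamental_theorem_of_algebra by blast
    then obtain q where pq: "p = [:- z, 1:] * q" by (auto simp: poly_eq_0_iff_dvd)
    have q: "q \<noteq> 0" using Suc.prems(1) pq by auto
    have "degree p = Suc (degree q)"
      unfolding pq using q by (subst degree_mult_eq) auto
    then have deg: "k = degree q" using Suc.hyps(2) by simp
    define w where "w = poly_act A q v"
    have w: "A *v w = z *s w"
      using Suc.prems(2) unfolding pq poly_act_linear_factor w_def by simp
    show ?case
    proof (cases "w = 0")
      case True
      then show ?thesis using Suc.hyps(1)[OF deg q] by (simp add: w_def)
    next
      case False
      define u where "u = A *v v - z *s v"
      have "poly_act A q u = 0"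
        using w by (simp add: u_def poly_act_diff poly_act_commute poly_act_scale w_def)
      then have lim: "(\<lambda>n. ((*v) A ^^ n) u) \<longlonglongrightarrow> 0"
        by (rule Suc.hyps(1)[OF deg q])
      have step: "((*v) A ^^ Suc n) v = z *s (((*v) A ^^ n) v) + ((*v) A ^^ n) u" for n
        by (induction n)
           (simp_all add: u_def matrix_vector_right_distrib vec.scale)
      show ?thesis
      proof (rule contracting_recursion_tendsto_zero)
        show "norm (((*v) A ^^ Suc n) v)
              \<le> cmod z * norm (((*v) A ^^ n) v) + norm (((*v) A ^^ n) u)" for n
          unfolding step by (metis norm_triangle_ineq norm_vector_scalar_mult)
        show "cmod z < 1" using eig[OF False w] .
        show "(\<lambda>n. norm (((*v) A ^^ n) u)) \<longlonglongrightarrow> 0"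
          using lim by (rule tendsto_norm_zero)
      qed simp
    qed
  qed
  then show ?thesis using annihilating_poly_exists by blast
qed

lemma
  fixes R :: "'a::comm_semiring_1 ^ 'n ^ 'n"
  assumes "invertible R"
  shows matrix_inv_right: "R ** matrix_inv R = mat 1"
    and matrix_inv_left: "matrix_inv R ** R = mat 1"
  using someI_ex[OF assms[unfolded invertible_def]] by (simp_all add: matrix_inv_def)

lemma expansive_invertible:
  assumes "expansive R"
  shows "invertible R"
proof -
  have "inj ((*v) R)"
  proof (rule ccontr)
    assume "\<not> inj ((*v) R)"
    then obtain x where x: "x \<noteq> 0" "R *v x = 0"
      by (auto simp: linear_injective_0[OF matrix_vector_mul_linear])
    define w :: "complex ^ 'a" where "w = (\<chi> i. complex_of_real (x $ i))"
    have "w \<noteq> 0" using x(1) by (auto simp: w_def vec_eq_iff)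
    moreover have "(\<chi> i j. complex_of_real (R $ i $ j)) *v w = 0 *s w"
      using x(2) by (simp add: vec_eq_iff matrix_vector_mult_def w_def flip: of_real_mult of_real_sum)
    ultimately have "complex_eigenvalue R 0" unfolding complex_eigenvalue_def by blast
    then show False using assms by (force simp: expansive_def)
  qed
  then show ?thesis
    by (simp add: invertible_left_inverse matrix_left_invertible_injective)
qed

text \<open>
  The eigenvalues of the inverse are the inverses of the eigenvalues of \<open>R\<close>, so they lie in the
  open unit disc.  The real vector is embedded into the complex space, where the eigenvalues live.
\<close>
lemma expansive_inverse_powers_tendsto_zero:
  fixes R :: "real ^ 'd ^ 'd"
  assumes "expansive R"
  shows "(\<lambda>n. ((*v) (matrix_inv R) ^^ n) x) \<longlonglongrightarrow> 0"
proof -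
  define cm :: "real ^ 'd ^ 'd \<Rightarrow> complex ^ 'd ^ 'd"
    where "cm T = (\<chi> i j. complex_of_real (T $ i $ j))" for T
  define cv :: "real ^ 'd \<Rightarrow> complex ^ 'd"
    where "cv y = (\<chi> i. complex_of_real (y $ i))" for y
  let ?Q = "matrix_inv R"
  have cmcv: "cm T *v cv y = cv (T *v y)" for T y
    by (simp add: vec_eq_iff cm_def cv_def matrix_vector_mult_def)
  have cmcm: "cm T ** cm T' = cm (T ** T')" for T T'
    by (simp add: vec_eq_iff cm_def matrix_matrix_mult_def)
  have cm1: "cm (mat 1) = mat 1"
    by (simp add: vec_eq_iff cm_def mat_def)
  have RQ: "cm R ** cm ?Q = mat 1"
    using matrix_inv_right[OF expansive_invertible[OF assms]] by (simp add: cmcm cm1)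
  have "(\<lambda>n. ((*v) (cm ?Q) ^^ n) (cv x)) \<longlonglongrightarrow> 0"
  proof (rule matrix_powers_tendsto_zero)
    fix z w assume w: "w \<noteq> 0" "cm ?Q *v w = z *s w"
    have "w = cm R *v (z *s w)"
      using RQ by (metis matrix_vector_mul_assoc matrix_vector_mul_lid w(2))
    then have *: "z *s (cm R *v w) = w" by (simp add: vec.scale)
    then have z: "z \<noteq> 0" using w(1) by auto
    have "cm R *v w = inverse z *s (z *s (cm R *v w))"
      using z by simp
    then have "cm R *v w = inverse z *s w" by (simp only: *)
    then have "complex_eigenvalue R (inverse z)"
      using w(1) by (auto simp: complex_eigenvalue_def cm_def)
    then have "1 < cmod (inverse z)" using assms by (simp add: expansive_def)
    then show "cmod z < 1" using z by (simp add: norm_inverse one_less_inverse_iff)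
  qed
  moreover have "((*v) (cm ?Q) ^^ n) (cv x) = cv (((*v) ?Q ^^ n) x)" for n
    by (induction n) (simp_all add: cmcv)
  ultimately have "(\<lambda>n. cv (((*v) ?Q ^^ n) x)) \<longlonglongrightarrow> 0" by simp
  then have "(\<lambda>n. norm (cv (((*v) ?Q ^^ n) x))) \<longlonglongrightarrow> 0" by (rule tendsto_norm_zero)
  moreover have "norm (cv y) = norm y" for y by (simp add: cv_def norm_vec_def)
  ultimately show ?thesis by (simp add: tendsto_norm_zero_iff)
qed

lemma matrix_power_transpose_inner:
  fixes A :: "real ^ 'd ^ 'd"
  shows "(((*v) (transpose A) ^^ n) y) \<bullet> x = y \<bullet> (((*v) A ^^ n) x)"
proof (induction n arbitrary: x)
  case (Suc n)
  have adj: "(transpose A *v w) \<bullet> x = w \<bullet> (A *v x)" for w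
    by (simp add: dot_lmul_matrix)
  show ?case
    using adj[of "((*v) (transpose A) ^^ n) y"] Suc[of "A *v x"]
    by (simp only: funpow.simps o_apply funpow_swap1)
qed simp

lemma matrix_inv_transpose:
  fixes R :: "real ^ 'd ^ 'd"
  assumes "invertible R"
  shows "matrix_inv (transpose R) = transpose (matrix_inv R)"
proof -
  let ?T = "transpose R" and ?U = "transpose (matrix_inv R)"
  have U: "?T ** ?U = mat 1" "?U ** ?T = mat 1"
    by (simp_all add: matrix_inv_left[OF assms] matrix_inv_right[OF assms]
        flip: matrix_transpose_mul)
  then have "invertible ?T" unfolding invertible_def by blast
  then have "matrix_inv ?T ** ?T = mat 1" by (rule matrix_inv_left)
  then show ?thesis
    by (metis U(1) matrix_mul_assoc matrix_mul_lid matrix_mul_rid)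
qed

text \<open>
  Every coordinate is an inner product with a power of \<open>R\<close> inverse applied to a basis vector, so the transposed
  powers inherit the convergence without a second look at eigenvalues.
\<close>
lemma expansive_transpose_inverse_powers_tendsto_zero:
  fixes R :: "real ^ 'd ^ 'd"
  assumes "expansive R"
  shows "(\<lambda>n. ((*v) (matrix_inv (transpose R)) ^^ n) y) \<longlonglongrightarrow> 0"
proof (rule vec_tendstoI)
  fix i
  have "(((*v) (matrix_inv (transpose R)) ^^ n) y) $ i
        = y \<bullet> (((*v) (matrix_inv R) ^^ n) (axis i 1))" for n
    by (simp add: matrix_inv_transpose[OF expansive_invertible[OF assms]]
        inner_axis flip: matrix_power_transpose_inner)
  moreover have "(\<lambda>n. y \<bullet> (((*v) (matrix_inv R) ^^ n) (axis i 1))) \<longlonglongrightarrow> y \<bullet> 0"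
    by (intro tendsto_intros expansive_inverse_powers_tendsto_zero assms)
  ultimately show "(\<lambda>n. (((*v) (matrix_inv (transpose R)) ^^ n) y) $ i) \<longlonglongrightarrow> 0 $ i"
    by simp
qed

section \<open>Borel measures and continuous functions\<close>
text \<open>
  The indicator of a closed set \<open>C\<close> is the bounded pointwise limit of the continuous functions
  \<open>max 0 (1 - m * infdist x C)\<close>, so the measures agree on closed sets, which form a generator of
  the Borel sets that is stable under intersections.
\<close>
lemma finite_borel_measure_eqI_continuous:
  fixes M P :: "'a::metric_space measure"
  assumes "finite_measure M" "finite_measure P"
    and sets_M: "sets M = sets borel" and sets_P: "sets P = sets borel"
    and eq: "\<And>f :: 'a \<Rightarrow> complex. continuous_on UNIV f \<Longrightarrow> (\<And>x. cmod (f x) \<le> 1)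
               \<Longrightarrow> (LINT x|M. f x) = (LINT x|P. f x)"
  shows "M = P"
proof -
  interpret M: finite_measure M by fact
  interpret P: finite_measure P by fact
  have closed_eq: "measure M C = measure P C" if C: "closed C" for C
  proof (cases "C = {}")
    case False
    define f :: "nat \<Rightarrow> 'a \<Rightarrow> real" where "f m x = max 0 (1 - real m * infdist x C)" for m x
    have cont: "continuous_on UNIV (f m)" for m
      unfolding f_def by (intro continuous_intros)
    have bound: "\<bar>f m x\<bar> \<le> 1" for m x
      by (auto simp: f_def infdist_nonneg)
    have lim: "(\<lambda>m. f m x) \<longlonglongrightarrow> indicator C x" for x
    proof (cases "x \<in> C")
      case True
      then show ?thesis by (simp add: f_def)
    next
      case xC: False
      then have pos: "infdist x C > 0"
        using in_closed_iff_infdist_zero[OF C False] infdist_nonneg[of x C] by force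
      obtain m0 where "1 / infdist x C < real m0" using reals_Archimedean2 by blast
      then have "1 < real m * infdist x C" if "m \<ge> m0" for m
        using that pos by (smt (verit) of_nat_le_iff pos_divide_less_eq)
      then have "\<forall>\<^sub>F m in sequentially. f m x = 0"
        by (intro eventually_sequentiallyI[of m0]) (force simp: f_def)
      then show ?thesis using xC by (simp add: tendsto_eventually)
    qed
    have conv: "(\<lambda>m. LINT x|Q. f m x) \<longlonglongrightarrow> measure Q C"
      if Q: "finite_measure Q" "sets Q = sets borel" for Q
    proof -
      interpret Q: finite_measure Q by fact
      have spQ: "space Q = UNIV" using sets_eq_imp_space_eq[OF Q(2)] by simp
      have "(\<lambda>m. LINT x|Q. f m x) \<longlonglongrightarrow> (LINT x|Q. indicator C x)"
      proof (rule integral_dominated_convergence[where w = "\<lambda>_. 1"])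
        show "f m \<in> borel_measurable Q" for m
          using borel_measurable_continuous_onI[OF cont] Q(2) by (simp cong: measurable_cong_sets)
        show "(indicator C :: 'a \<Rightarrow> real) \<in> borel_measurable Q"
          using C Q(2) by (simp add: borel_closed borel_measurable_indicator)
      qed (use lim bound in auto)
      then show ?thesis by (simp add: spQ)
    qed
    have "(LINT x|M. f m x) = (LINT x|P. f m x)" for m
    proof -
      have "(LINT x|M. complex_of_real (f m x)) = (LINT x|P. complex_of_real (f m x))"
        using bound by (intro eq continuous_on_of_real cont) auto
      then show ?thesis by simp
    qed
    then show ?thesis
      using conv[OF assms(1) sets_M] conv[OF assms(2) sets_P] LIMSEQ_unique by simp
  qed simp
  show ?thesis
  proof (rule measure_eqI_generator_eq[where E = "Collect closed" and \<Omega> = UNIV and A = "\<lambda>_. UNIV"])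
    show "Int_stable (Collect closed :: 'a set set)" by (auto simp: Int_stable_def)
    show "emeasure M C = emeasure P C" if "C \<in> Collect closed" for C
      using closed_eq that by (simp add: M.emeasure_eq_measure P.emeasure_eq_measure)
    show "sets M = sigma_sets UNIV (Collect closed)" "sets P = sigma_sets UNIV (Collect closed)"
      by (simp_all add: sets_M sets_P borel_eq_closed)
  qed auto
qed

section \<open>Words and their affine maps\<close>
lemma matrix_power_add:
  fixes A :: "real ^ 'd ^ 'd"
  shows "((*v) A ^^ n) (x + y) = ((*v) A ^^ n) x + ((*v) A ^^ n) y"
  by (induction n) (simp_all add: matrix_vector_right_distrib)

lemma continuous_on_matrix_power:
  fixes A :: "real ^ 'd ^ 'd"
  shows "continuous_on S ((*v) A ^^ n)"
  by (induction n arbitrary: S) (auto intro!: continuous_on_compose2[OF matrix_vector_mult_linear_continuous_on])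

lemma tau_word_Nil [simp]: "tau_word R [] x = x"
  by (simp add: tau_word_def)

lemma tau_word_Cons [simp]: "tau_word R (b # k) x = tau_word R k (tau R b x)"
  by (simp add: tau_word_def)

text \<open>
  All the maps of level \<open>n\<close> have the same linear part, so they differ only by their value at 0.
  This is what factors the integral of an exponential over a cylinder into an entry of \<open>A_n\<close> and
  a number that does not depend on the cylinder.
\<close>
lemma tau_word_affine:
  "tau_word R k x = ((*v) (matrix_inv R) ^^ length k) x + tau_word R k 0"
proof (induction k arbitrary: x)
  case (Cons b k)
  let ?Q = "(*v) (matrix_inv R)"
  have "tau_word R (b # k) x = (?Q ^^ length k) (?Q x + ?Q b) + tau_word R k 0"
    by (simp add: Cons[of "tau R b x"]) (simp add: tau_def matrix_vector_right_distrib)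
  moreover have "tau_word R (b # k) 0 = (?Q ^^ length k) (?Q b) + tau_word R k 0"
    by (simp add: Cons[of "tau R b 0"]) (simp add: tau_def)
  ultimately show ?case by (simp add: matrix_power_add funpow_swap1)
qed simp

lemma continuous_on_tau_word [continuous_intros]: "continuous_on S (tau_word R k)"
  by (subst tau_word_affine[abs_def]) (intro continuous_intros continuous_on_matrix_power)

lemma words_0 [simp]: "words B 0 = {[]}"
  by (auto simp: words_def)

lemma words_Suc: "words B (Suc n) = (\<lambda>(b, k). b # k) ` (B \<times> words B n)"
  by (auto simp: words_def length_Suc_conv image_iff)

lemma sum_words_Suc:
  "(\<Sum>k\<in>words B (Suc n). g k) = (\<Sum>b\<in>B. \<Sum>k\<in>words B n. g (b # k))"
  unfolding words_Suc
  by (subst sum.reindex) (auto simp: inj_on_def sum.cartesian_product intro!: sum.cong)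

lemma finite_words: "finite B \<Longrightarrow> finite (words B n)"
  by (induction n) (simp_all add: words_Suc)

lemma card_words: "finite B \<Longrightarrow> card (words B n) = card B ^ n"
  unfolding words_def using card_lists_length_eq[of B n] by (simp add: conj_commute)

section \<open>Self-similarity and support of the invariant measure\<close>
locale ifs_measure =
  fixes R :: "real ^ 'd ^ 'd" and B :: "(real ^ 'd) set" and M :: "(real ^ 'd) measure"
  assumes expansive: "expansive R"
    and finite_B: "finite B" and B_nonempty: "B \<noteq> {}"
    and invariant: "invariant_measure R B M"
begin

lemma prob_space_M: "prob_space M"
  using invariant by (simp add: invariant_measure_def)

sublocale prob_space M
  by (rule prob_space_M)

lemma sets_M [measurable_cong, simp]: "sets M = sets borel"
  using invariant by (simp add: invariant_measure_def)

lemma space_M [simp]: "space M = UNIV"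
  using sets_eq_imp_space_eq[OF sets_M] by simp

lemma measurable_M_eq: "measurable M N = measurable borel N"
  by (rule measurable_cong_sets) simp_all

lemma measurable_tau_word [measurable]: "tau_word R k \<in> borel_measurable borel"
  by (intro borel_measurable_continuous_onI continuous_on_tau_word)

lemma tau_eq_tau_word: "tau R b = tau_word R [b]"
  by (simp add: fun_eq_iff)

lemma measurable_tau [measurable]: "tau R b \<in> borel_measurable borel"
  unfolding tau_eq_tau_word by (rule measurable_tau_word)

lemma integrable_bounded_borel:
  fixes f :: "real ^ 'd \<Rightarrow> 'e::{banach, second_countable_topology}"
  assumes "f \<in> borel_measurable borel" "\<And>x. norm (f x) \<le> c"
  shows "integrable M f"
  using assms by (intro integrable_const_bound[of _ c]) (auto simp: measurable_M_eq)

text \<open>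
  The defining property of the invariant measure is about continuous functions; indicators of the
  cylinders require bounded Borel functions.  The right-hand side is the integral against the
  measure \<open>P\<close> of \<open>tau R b x\<close> for a uniformly random \<open>b\<close> and an independent \<open>x\<close>
  with law \<open>M\<close>, and \<open>P = M\<close> because the two have the same integrals of continuous functions.
\<close>
lemma integral_tau:
  fixes f :: "real ^ 'd \<Rightarrow> 'e::{banach, second_countable_topology}"
  assumes f: "f \<in> borel_measurable borel" "\<And>x. norm (f x) \<le> c"
  shows "(LINT x|M. f x) = (1 / real (card B)) *\<^sub>R (\<Sum>b\<in>B. LINT x|M. f (tau R b x))"
proof -
  define U where "U = uniform_count_measure B"
  define T where "T = (\<lambda>(b, x). tau R b x)"
  define P where "P = distr (U \<Otimes>\<^sub>M M) borel T"
  interpret U: prob_space U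
    unfolding U_def by (rule prob_space_uniform_count_measure[OF finite_B B_nonempty])
  interpret UM: pair_prob_space U M ..
  have T [measurable]: "T \<in> borel_measurable (U \<Otimes>\<^sub>M M)"
  proof -
    have "T \<in> borel_measurable (count_space B \<Otimes>\<^sub>M M)"
      unfolding T_def
      by (rule measurable_pair_measure_countable1)
         (use finite_B in \<open>auto simp: measurable_M_eq intro: countable_finite\<close>)
    then show ?thesis
      by (rule measurable_cong_sets[THEN equalityD1, THEN subsetD, rotated -1])
         (auto intro!: sets_pair_measure_cong simp: U_def sets_uniform_count_measure)
  qed
  have integral_P: "(LINT x|P. g x) = (1 / real (card B)) *\<^sub>R (\<Sum>b\<in>B. LINT x|M. g (tau R b x))"
    if g: "g \<in> borel_measurable borel" "\<And>x. norm (g x) \<le> c"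
    for g :: "real ^ 'd \<Rightarrow> 'b::{banach, second_countable_topology}" and c
  proof -
    have "(LINT x|P. g x) = (LINT p|(U \<Otimes>\<^sub>M M). g (T p))"
      unfolding P_def by (rule integral_distr[OF T g(1)])
    also have "\<dots> = (LINT b|U. (LINT x|M. g (T (b, x))))"
    proof (rule UM.integral_fst'[symmetric])
      show "integrable (U \<Otimes>\<^sub>M M) (\<lambda>p. g (T p))"
        by (intro UM.integrable_const_bound[of _ c] measurable_compose[OF T g(1)])
           (simp add: g(2))
    qed
    also have "\<dots> = (1 / real (card B)) *\<^sub>R (\<Sum>b\<in>B. LINT x|M. g (tau R b x))"
      using finite_B
      by (simp add: U_def uniform_count_measure_def lebesgue_integral_point_measure_finite
          T_def scaleR_sum_right)
    finally show ?thesis .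
  qed
  have "M = P"
  proof (rule finite_borel_measure_eqI_continuous)
    show "finite_measure M" by unfold_locales
    show "finite_measure P"
      unfolding P_def by (intro prob_space.finite_measure UM.prob_space_distr T)
    fix f :: "real ^ 'd \<Rightarrow> complex"
    assume cont: "continuous_on UNIV f" and le: "\<And>x. cmod (f x) \<le> 1"
    have "(LINT x|M. f x) = 1 / of_nat (card B) * (\<Sum>b\<in>B. LINT x|M. f (tau R b x))"
      using invariant cont unfolding invariant_measure_def by blast
    also have "\<dots> = (LINT x|P. f x)"
      by (subst integral_P[OF borel_measurable_continuous_onI[OF cont] le])
         (simp add: scaleR_conv_of_real)
    finally show "(LINT x|M. f x) = (LINT x|P. f x)" .
  qed (simp_all add: P_def)
  then show ?thesis using integral_P[OF f] by simp
qed

lemma integral_tau_word: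
  fixes f :: "real ^ 'd \<Rightarrow> 'e::{banach, second_countable_topology}"
  assumes f: "f \<in> borel_measurable borel" "\<And>x. norm (f x) \<le> c"
  shows "(LINT x|M. f x)
    = (1 / real (card B) ^ n) *\<^sub>R (\<Sum>k\<in>words B n. LINT x|M. f (tau_word R k x))"
proof (induction n)
  case (Suc n)
  have "(LINT x|M. f (tau_word R k x))
      = (1 / real (card B)) *\<^sub>R (\<Sum>b\<in>B. LINT x|M. f (tau_word R (b # k) x))" for k
    using f by (subst integral_tau[where c = c]) (auto intro: measurable_compose[OF measurable_tau_word])
  then show ?case
    unfolding Suc sum_words_Suc
    by (subst sum.swap) (simp add: scaleR_sum_right mult.commute)
qed simp

lemma tau_word_attractor:
  assumes "attractor R B X" "set k \<subseteq> B" "x \<in> X"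
  shows "tau_word R k x \<in> X"
  using assms(2,3)
proof (induction k arbitrary: x)
  case (Cons b k)
  have X: "(\<Union>b\<in>B. tau R b ` X) = X"
    using assms(1) unfolding attractor_def by (elim conjE) (rule sym)
  have "tau R b x \<in> (\<Union>b\<in>B. tau R b ` X)"
    by (rule UN_I[of b]) (use Cons.prems in simp_all)
  then have "tau R b x \<in> X" by (simp only: X)
  then show ?case using Cons by simp
qed simp

text \<open>
  Let \<open>x0\<close> be a point of the attractor.  Every word of length \<open>n\<close> maps \<open>x0\<close> into the attractor,
  and \<open>x\<close> to a point at distance \<open>norm (q (x - x0))\<close> from there, where \<open>q\<close> is the \<open>n\<close>-th power of
  the inverse of \<open>R\<close>, the same for all words.  By self-similarity the mean distance to the
  attractor, truncated at 1, is at most the mean of the truncated \<open>norm (q (x - x0))\<close>, which tends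
  to 0 by dominated convergence.
\<close>
lemma AE_attractor:
  assumes X: "attractor R B X"
  shows "AE x in M. x \<in> X"
proof -
  let ?Q = "(*v) (matrix_inv R)"
  obtain x0 where x0: "x0 \<in> X" using X by (auto simp: attractor_def)
  have closed: "closed X" using X by (simp add: attractor_def compact_imp_closed)
  define f where "f x = min 1 (infdist x X)" for x
  have f_cont: "continuous_on UNIV f" unfolding f_def by (intro continuous_intros)
  have f_meas: "f \<in> borel_measurable borel"
    by (rule borel_measurable_continuous_onI[OF f_cont])
  have f_bounds: "0 \<le> f x" "f x \<le> 1" for x by (auto simp: f_def infdist_nonneg)
  define g where "g n x = min 1 (norm ((?Q ^^ n) (x - x0)))" for n x
  have g_meas: "g n \<in> borel_measurable borel" for n
  proof -
    have "continuous_on UNIV (\<lambda>x. (?Q ^^ n) (x - x0))"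
      by (rule continuous_on_compose2[OF continuous_on_matrix_power[of UNIV]])
         (auto intro: continuous_intros)
    then show ?thesis
      unfolding g_def by (intro borel_measurable_continuous_onI continuous_intros)
  qed
  have fg: "f (tau_word R k x) \<le> g n x" if "k \<in> words B n" for k n x
  proof -
    have k: "set k \<subseteq> B" "length k = n" using that by (auto simp: words_def)
    have "infdist (tau_word R k x) X \<le> dist (tau_word R k x) (tau_word R k x0)"
      by (intro infdist_le tau_word_attractor[OF X k(1) x0])
    also have "\<dots> = norm ((?Q ^^ n) x - (?Q ^^ n) x0)"
      by (simp add: tau_word_affine[of R k x] tau_word_affine[of R k x0] k(2) dist_norm)
    also have "(?Q ^^ n) x - (?Q ^^ n) x0 = (?Q ^^ n) (x - x0)"
      using matrix_power_add[of n "matrix_inv R" "x - x0" x0] by simp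
    finally show ?thesis by (simp add: f_def g_def min.coboundedI2)
  qed
  have le: "(LINT x|M. f x) \<le> (LINT x|M. g n x)" for n
  proof -
    have "(LINT x|M. f x)
        = (1 / real (card B) ^ n) * (\<Sum>k\<in>words B n. LINT x|M. f (tau_word R k x))"
      using integral_tau_word[OF f_meas, of 1 n] f_bounds by simp
    also have "\<dots> \<le> (1 / real (card B) ^ n) * (\<Sum>k\<in>words B n. LINT x|M. g n x)"
    proof (intro mult_left_mono sum_mono integral_mono)
      show "integrable M (\<lambda>x. f (tau_word R k x))" for k
        using f_meas f_bounds by (intro integrable_bounded_borel[where c = 1]) auto
      show "integrable M (g n)"
        by (rule integrable_bounded_borel[OF g_meas, where c = 1]) (auto simp: g_def)
    qed (auto intro: fg)
    also have "\<dots> = (LINT x|M. g n x)"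
      using finite_B B_nonempty by (simp add: card_words)
    finally show ?thesis .
  qed
  have "(\<lambda>n. LINT x|M. g n x) \<longlonglongrightarrow> (LINT x|M. 0)"
  proof (rule integral_dominated_convergence[where w = "\<lambda>_. 1"])
    have "(\<lambda>n. g n x) \<longlonglongrightarrow> min 1 (norm (0 :: real ^ 'd))" for x
      unfolding g_def
      by (intro tendsto_intros expansive_inverse_powers_tendsto_zero expansive)
    then show "AE x in M. (\<lambda>n. g n x) \<longlonglongrightarrow> 0" by simp
    show "g n \<in> borel_measurable M" for n by (simp add: measurable_M_eq g_meas)
  qed (auto simp: g_def)
  then have "(LINT x|M. f x) \<le> 0"
    using LIMSEQ_le_const[of _ 0 "LINT x|M. f x"] le by auto
  moreover have "0 \<le> (LINT x|M. f x)"
    using f_bounds by (intro Bochner_Integration.integral_nonneg) auto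
  ultimately have "(LINT x|M. f x) = 0" by (rule antisym)
  moreover have "integrable M f"
    using f_bounds by (intro integrable_bounded_borel[OF f_meas, where c = 1]) auto
  ultimately have "AE x in M. f x = 0"
    using integral_nonneg_eq_0_iff_AE[of M f] f_bounds by simp
  then show ?thesis
  proof (rule AE_mp, intro AE_I2 impI)
    fix x assume "f x = 0"
    then have "infdist x X = 0" by (auto simp: f_def min_def split: if_splits)
    then show "x \<in> X" using in_closed_iff_infdist_zero[OF closed] x0 by auto
  qed
qed

end

section \<open>Operator norms and duality\<close>
lemma sum_bounds_imp_summable:
  fixes f :: "'i \<Rightarrow> real"
  assumes "\<And>i. i \<in> I \<Longrightarrow> 0 \<le> f i"
    and "\<And>F. finite F \<Longrightarrow> F \<subseteq> I \<Longrightarrow> sum f F \<le> b"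
  shows "f summable_on I" and "infsum f I \<le> b"
proof -
  show "f summable_on I"
    using assms by (intro nonneg_bdd_above_summable_on bdd_aboveI2) auto
  then show "infsum f I \<le> b"
    using assms(2) by (rule infsum_le_finite_sums)
qed

lemma ell2_norm_le_iff:
  assumes "C \<ge> 0"
  shows "ell2_norm I x \<le> ennreal C \<longleftrightarrow>
    (\<forall>F. finite F \<longrightarrow> F \<subseteq> I \<longrightarrow> (\<Sum>i\<in>F. (cmod (x i))\<^sup>2) \<le> C\<^sup>2)" (is "?L \<longleftrightarrow> ?R")
proof
  assume ?L
  then have s: "(\<lambda>i. (cmod (x i))\<^sup>2) summable_on I"
    and le: "sqrt (\<Sum>\<^sub>\<infinity>i\<in>I. (cmod (x i))\<^sup>2) \<le> C"
    using assms by (auto simp: ell2_norm_def top_unique split: if_splits)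
  from le have "(\<Sum>\<^sub>\<infinity>i\<in>I. (cmod (x i))\<^sup>2) \<le> C\<^sup>2"
    by (rule sqrt_le_D)
  moreover have "(\<Sum>i\<in>F. (cmod (x i))\<^sup>2) \<le> (\<Sum>\<^sub>\<infinity>i\<in>I. (cmod (x i))\<^sup>2)"
    if "finite F" "F \<subseteq> I" for F
    using s that by (intro finite_sum_le_infsum) auto
  ultimately show ?R by force
next
  assume ?R
  then have "(\<lambda>i. (cmod (x i))\<^sup>2) summable_on I"
    "(\<Sum>\<^sub>\<infinity>i\<in>I. (cmod (x i))\<^sup>2) \<le> C\<^sup>2"
    using sum_bounds_imp_summable[of I "\<lambda>i. (cmod (x i))\<^sup>2" "C\<^sup>2"] by auto
  then show ?L
    using assms by (auto simp: ell2_norm_def intro!: ennreal_leI real_le_lsqrt infsum_nonneg)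
qed

text \<open>
  Scaling extends the bound from the unit ball to all vectors.  The rows may be infinitely many;
  testing finite sets of rows turns the extended norm into finite sums.
\<close>
lemma matrix_norm_le_iff:
  assumes J: "finite J" and C: "C \<ge> 0"
  shows "matrix_norm I J A \<le> ennreal C \<longleftrightarrow>
    (\<forall>a F. finite F \<longrightarrow> F \<subseteq> I \<longrightarrow>
       (\<Sum>i\<in>F. (cmod (\<Sum>j\<in>J. A i j * a j))\<^sup>2) \<le> C\<^sup>2 * (\<Sum>j\<in>J. (cmod (a j))\<^sup>2))"
    (is "?L \<longleftrightarrow> ?R")
proof
  assume ?L
  then have unit: "ell2_norm I (\<lambda>i. \<Sum>j\<in>J. A i j * a j) \<le> ennreal C"
    if "ell2_norm J a \<le> 1" for a
    using that by (auto simp: matrix_norm_def SUP_le_iff)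
  show ?R
  proof (intro allI impI)
    fix a F assume F: "finite F" "F \<subseteq> I"
    define s where "s = (\<Sum>j\<in>J. (cmod (a j))\<^sup>2)"
    have s: "s \<ge> 0" unfolding s_def by (intro sum_nonneg) auto
    show "(\<Sum>i\<in>F. (cmod (\<Sum>j\<in>J. A i j * a j))\<^sup>2) \<le> C\<^sup>2 * (\<Sum>j\<in>J. (cmod (a j))\<^sup>2)"
    proof (cases "s = 0")
      case True
      then have "\<forall>j\<in>J. a j = 0" using J by (simp add: s_def sum_nonneg_eq_0_iff)
      then show ?thesis by simp
    next
      case False
      then have pos: "s > 0" using s by simp
      define a' where "a' j = a j / complex_of_real (sqrt s)" for j
      have "(\<Sum>j\<in>G. (cmod (a' j))\<^sup>2) \<le> 1" if "G \<subseteq> J" for G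
      proof -
        have "(\<Sum>j\<in>G. (cmod (a' j))\<^sup>2) = (\<Sum>j\<in>G. (cmod (a j))\<^sup>2) / s"
          using pos by (simp add: a'_def norm_divide power_divide sum_divide_distrib)
        also have "(\<Sum>j\<in>G. (cmod (a j))\<^sup>2) \<le> s"
          unfolding s_def using J that by (intro sum_mono2) auto
        finally show ?thesis using pos by (simp add: divide_right_mono)
      qed
      then have "ell2_norm J a' \<le> ennreal 1" by (subst ell2_norm_le_iff) auto
      then have "(\<Sum>i\<in>F. (cmod (\<Sum>j\<in>J. A i j * a' j))\<^sup>2) \<le> C\<^sup>2"
        using unit[of a'] F unfolding ell2_norm_le_iff[OF C] by simp
      then have "s * (\<Sum>i\<in>F. (cmod (\<Sum>j\<in>J. A i j * a' j))\<^sup>2) \<le> s * C\<^sup>2"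
        using pos by (intro mult_left_mono) auto
      moreover have "(cmod (\<Sum>j\<in>J. A i j * a j))\<^sup>2 = s * (cmod (\<Sum>j\<in>J. A i j * a' j))\<^sup>2" for i
        using pos by (simp add: a'_def norm_divide power_divide flip: sum_divide_distrib)
      ultimately show ?thesis
        by (simp add: mult.commute flip: sum_distrib_left s_def)
    qed
  qed
next
  assume R: ?R
  show ?L
    unfolding matrix_norm_def
  proof (rule SUP_least)
    fix a assume "a \<in> {a. ell2_norm J a \<le> 1}"
    then have "ell2_norm J a \<le> ennreal 1" by simp
    then have a: "(\<Sum>j\<in>J. (cmod (a j))\<^sup>2) \<le> 1"
      using J by (subst (asm) ell2_norm_le_iff) auto
    have "(\<Sum>i\<in>F. (cmod (\<Sum>j\<in>J. A i j * a j))\<^sup>2) \<le> C\<^sup>2" if "finite F" "F \<subseteq> I" for F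
    proof -
      have "(\<Sum>i\<in>F. (cmod (\<Sum>j\<in>J. A i j * a j))\<^sup>2) \<le> C\<^sup>2 * (\<Sum>j\<in>J. (cmod (a j))\<^sup>2)"
        using R that by blast
      also have "\<dots> \<le> C\<^sup>2 * 1" using a by (intro mult_left_mono) auto
      finally show ?thesis by simp
    qed
    then show "ell2_norm I (\<lambda>i. \<Sum>j\<in>J. A i j * a j) \<le> ennreal C"
      using ell2_norm_le_iff[OF C] by blast
  qed
qed

text \<open>
  With this inequality in place of the Cauchy-Schwarz inequality, both duality arguments below
  end in \<open>T \<le> (K * s + T) / 2\<close>, which is \<open>T \<le> K * s\<close>.
\<close>
lemma weighted_arith_geo_mean:
  fixes x y K :: real
  assumes "K > 0"
  shows "x * y \<le> (K * x\<^sup>2 + y\<^sup>2 / K) / 2"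
proof -
  have "0 \<le> (K * x - y)\<^sup>2 / K" using assms by simp
  also have "\<dots> = K * x\<^sup>2 + y\<^sup>2 / K - 2 * (x * y)"
    using assms by (simp add: field_simps power2_eq_square)
  finally show ?thesis by simp
qed

lemma sum_norm_square_conv:
  "complex_of_real (\<Sum>i\<in>I. (cmod (c i))\<^sup>2) = (\<Sum>i\<in>I. c i * cnj (c i))"
  by (simp only: of_real_sum complex_norm_square)

text \<open>
  An operator and its adjoint have the same norm: pair the image \<open>b\<close> of \<open>c\<close> under the adjoint with
  itself and move the matrix to the other side.
\<close>
lemma adjoint_matrix_bound:
  fixes A :: "'i \<Rightarrow> 'j \<Rightarrow> complex"
  assumes K: "K > 0"
    and bound: "\<And>a. (\<Sum>i\<in>I. (cmod (\<Sum>j\<in>J. A i j * a j))\<^sup>2) \<le> K * (\<Sum>j\<in>J. (cmod (a j))\<^sup>2)"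
  shows "(\<Sum>j\<in>J. (cmod (\<Sum>i\<in>I. cnj (A i j) * c i))\<^sup>2) \<le> K * (\<Sum>i\<in>I. (cmod (c i))\<^sup>2)"
proof -
  define b where "b j = (\<Sum>i\<in>I. cnj (A i j) * c i)" for j
  define y where "y i = (\<Sum>j\<in>J. A i j * b j)" for i
  define T where "T = (\<Sum>j\<in>J. (cmod (b j))\<^sup>2)"
  have T0: "T \<ge> 0" unfolding T_def by (intro sum_nonneg) auto
  have "complex_of_real T = (\<Sum>j\<in>J. b j * cnj (b j))"
    unfolding T_def by (rule sum_norm_square_conv)
  also have "\<dots> = (\<Sum>j\<in>J. \<Sum>i\<in>I. A i j * b j * cnj (c i))"
    by (simp add: b_def[of _, THEN arg_cong[where f = cnj]] sum_distrib_left mult_ac)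
  also have "\<dots> = (\<Sum>i\<in>I. y i * cnj (c i))"
    by (subst sum.swap) (simp add: y_def sum_distrib_right)
  finally have "T = cmod (\<Sum>i\<in>I. y i * cnj (c i))"
    using T0 by (metis abs_of_nonneg norm_of_real)
  also have "\<dots> \<le> (\<Sum>i\<in>I. cmod (c i) * cmod (y i))"
    by (rule order_trans[OF norm_sum]) (simp add: norm_mult mult.commute)
  also have "\<dots> \<le> (\<Sum>i\<in>I. (K * (cmod (c i))\<^sup>2 + (cmod (y i))\<^sup>2 / K) / 2)"
    by (intro sum_mono weighted_arith_geo_mean K)
  also have "\<dots> = (K * (\<Sum>i\<in>I. (cmod (c i))\<^sup>2) + (\<Sum>i\<in>I. (cmod (y i))\<^sup>2) / K) / 2"
    by (simp add: sum.distrib sum_distrib_left flip: sum_divide_distrib)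
  also have "(\<Sum>i\<in>I. (cmod (y i))\<^sup>2) \<le> K * T"
    unfolding y_def T_def by (rule bound)
  finally have "T \<le> (K * (\<Sum>i\<in>I. (cmod (c i))\<^sup>2) + T) / 2"
    using K by (simp add: divide_right_mono)
  then show ?thesis by (simp add: T_def b_def)
qed

text \<open>
  The same duality between the synthesis operator \<open>c \<mapsto> \<Sum> c i * f i\<close> and the analysis operator
  \<open>v \<mapsto> \<langle>v, f i\<rangle>\<close>: synthesize with the coefficients of \<open>v\<close> itself.
\<close>
lemma (in finite_measure) analysis_bound_if_synthesis_bound:
  fixes f :: "'i \<Rightarrow> 'a \<Rightarrow> complex"
  assumes K: "K > 0"
    and f: "\<And>i. i \<in> I \<Longrightarrow> f i \<in> borel_measurable M" "\<And>i x. i \<in> I \<Longrightarrow> cmod (f i x) \<le> 1"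
    and bound: "\<And>c. (LINT x|M. (cmod (\<Sum>i\<in>I. c i * f i x))\<^sup>2) \<le> K * (\<Sum>i\<in>I. (cmod (c i))\<^sup>2)"
    and v: "square_integrable M v"
  shows "(\<Sum>i\<in>I. (cmod (L2_inner M v (f i)))\<^sup>2) \<le> K * (LINT x|M. (cmod (v x))\<^sup>2)"
proof -
  define c where "c i = L2_inner M v (f i)" for i
  define g where "g x = (\<Sum>i\<in>I. c i * f i x)" for x
  define S where "S = (\<Sum>i\<in>I. (cmod (c i))\<^sup>2)"
  have S0: "S \<ge> 0" unfolding S_def by (intro sum_nonneg) auto
  have v_meas: "v \<in> borel_measurable M" and v_int: "integrable M (\<lambda>x. (cmod (v x))\<^sup>2)"
    using v by (auto simp: square_integrable_def)
  have g_meas: "g \<in> borel_measurable M"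
    unfolding g_def using f(1) by (intro borel_measurable_sum borel_measurable_times) auto
  have g_le: "cmod (g x) \<le> (\<Sum>i\<in>I. cmod (c i))" for x
    unfolding g_def using f(2)
    by (intro order_trans[OF norm_sum] sum_mono) (simp add: norm_mult mult_left_le)
  have g_int: "integrable M (\<lambda>x. (cmod (g x))\<^sup>2)"
    using g_meas g_le
    by (intro integrable_const_bound[of _ "(\<Sum>i\<in>I. cmod (c i))\<^sup>2"]) (auto intro!: power_mono)
  have vf_int: "integrable M (\<lambda>x. v x * cnj (f i x))" if i: "i \<in> I" for i
  proof (rule Bochner_Integration.integrable_bound)
    show "integrable M (\<lambda>x. 1 + (cmod (v x))\<^sup>2)" using v_int by simp
    show "(\<lambda>x. v x * cnj (f i x)) \<in> borel_measurable M"
      by (intro borel_measurable_times v_meas measurable_compose[OF f(1)[OF i]]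
          borel_measurable_continuous_onI continuous_on_cnj continuous_on_id)
    have "cmod (v x) * cmod (f i x) \<le> 1 + (cmod (v x))\<^sup>2" for x
    proof -
      have "cmod (v x) * cmod (f i x) \<le> cmod (v x) * 1"
        using f(2)[OF i] by (intro mult_left_mono) auto
      also have "\<dots> \<le> (1 * (cmod (v x))\<^sup>2 + 1\<^sup>2 / 1) / 2" by (rule weighted_arith_geo_mean) simp
      also have "\<dots> \<le> 1 + (cmod (v x))\<^sup>2" by simp
      finally show ?thesis .
    qed
    then show "AE x in M. norm (v x * cnj (f i x)) \<le> norm (1 + (cmod (v x))\<^sup>2)"
      by (simp add: norm_mult)
  qed
  have vg: "v x * cnj (g x) = (\<Sum>i\<in>I. cnj (c i) * (v x * cnj (f i x)))" for x
    by (simp add: g_def sum_distrib_left mult_ac)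
  have vg_int: "integrable M (\<lambda>x. v x * cnj (g x))"
    unfolding vg using vf_int by (intro Bochner_Integration.integrable_sum integrable_mult_right) auto
  have "complex_of_real S = (\<Sum>i\<in>I. cnj (c i) * c i)"
    unfolding S_def sum_norm_square_conv by (simp add: mult.commute)
  also have "\<dots> = (LINT x|M. v x * cnj (g x))"
    unfolding vg using vf_int
    by (subst Bochner_Integration.integral_sum) (auto simp: c_def L2_inner_def)
  finally have "S = cmod (LINT x|M. v x * cnj (g x))"
    using S0 by (metis abs_of_nonneg norm_of_real)
  also have "\<dots> \<le> (LINT x|M. cmod (v x * cnj (g x)))"
    by (rule integral_norm_bound)
  also have "\<dots> \<le> (LINT x|M. (K * (cmod (v x))\<^sup>2 + (cmod (g x))\<^sup>2 / K) / 2)"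
  proof (rule integral_mono)
    show "integrable M (\<lambda>x. cmod (v x * cnj (g x)))" using vg_int by simp
    show "integrable M (\<lambda>x. (K * (cmod (v x))\<^sup>2 + (cmod (g x))\<^sup>2 / K) / 2)"
      using v_int g_int by simp
  qed (simp only: norm_mult complex_mod_cnj weighted_arith_geo_mean[OF K])
  also have "\<dots> = (K * (LINT x|M. (cmod (v x))\<^sup>2) + (LINT x|M. (cmod (g x))\<^sup>2) / K) / 2"
    using v_int g_int by simp
  also have "(LINT x|M. (cmod (g x))\<^sup>2) \<le> K * S"
    unfolding g_def S_def by (rule bound)
  finally have "S \<le> (K * (LINT x|M. (cmod (v x))\<^sup>2) + S) / 2"
    using K by (simp add: divide_right_mono)
  then show ?thesis by (simp add: S_def c_def)
qed

section \<open>Bounded matrices give a Bessel spectrum\<close>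
lemma e_fun_add: "e_fun l (x + y) = e_fun l x * e_fun l y"
  by (simp add: e_fun_def inner_add_right distrib_left exp_add)

lemma cmod_e_fun [simp]: "cmod (e_fun l x) = 1"
  by (simp add: e_fun_def)

lemma cnj_e_fun: "cnj (e_fun l x) = exp (- 2 * of_real pi * \<i> * of_real (l \<bullet> x))"
  by (simp add: e_fun_def exp_cnj)

lemma continuous_on_e_fun [continuous_intros]: "continuous_on S (e_fun l)"
  unfolding e_fun_def[abs_def] by (intro continuous_intros)

lemma measurable_e_fun [measurable]: "e_fun l \<in> borel_measurable borel"
  by (intro borel_measurable_continuous_onI continuous_on_e_fun)

lemma A_entry_conv: "A_entry R N n l k = cnj (e_fun l (tau_word R k 0)) / complex_of_real (sqrt (real N ^ n))"
  by (simp add: A_entry_def cnj_e_fun)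

context ifs_measure
begin

text \<open>
  The sets \<open>Lambda_n\<close> exhaust \<open>L\<close> because the powers of the inverse of the transpose tend to 0.
\<close>
lemma finite_subset_Lambda_n:
  assumes "finite F" "F \<subseteq> L" "r > 0"
  obtains n where "F \<subseteq> Lambda_n R L n r"
proof -
  have "\<forall>\<^sub>F n in sequentially. norm (((*v) (matrix_inv (transpose R)) ^^ n) l) < r" for l
    using tendstoD[OF expansive_transpose_inverse_powers_tendsto_zero[OF expansive] \<open>r > 0\<close>, of l]
    by simp
  then have "\<forall>\<^sub>F n in sequentially. \<forall>l\<in>F. norm (((*v) (matrix_inv (transpose R)) ^^ n) l) < r"
    using \<open>finite F\<close> by (intro eventually_ball_finite) auto
  then obtain n where "\<forall>l\<in>F. norm (((*v) (matrix_inv (transpose R)) ^^ n) l) < r"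
    by (auto simp: eventually_sequentially)
  then show thesis
    using that[of n] assms(2) by (force simp: Lambda_n_def less_imp_le)
qed

text \<open>
  By self-similarity the integral is the integral over \<open>x\<close> of the mean of
  \<open>\<bar>\<Sum> c l * e_fun l (tau_word R k x)\<bar>\<^sup>2\<close> over the words \<open>k\<close>.  Since \<open>tau_word R k x\<close> is \<open>tau_word R k 0\<close>
  shifted by a vector common to all words, this mean is, for each fixed \<open>x\<close>, the squared norm of the
  adjoint of \<open>A_n\<close> at the coefficients \<open>c l\<close> multiplied by numbers of modulus 1.  The norm of
  a single matrix thus bounds the integral exactly, not just in the limit.
\<close>
lemma synthesis_bound:
  assumes C: "C > 0" and norm: "A_norm R B L n r \<le> ennreal C"
    and F: "finite F" "F \<subseteq> Lambda_n R L n r"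
  shows "(LINT x|M. (cmod (\<Sum>l\<in>F. c l * e_fun l x))\<^sup>2) \<le> C\<^sup>2 * (\<Sum>l\<in>F. (cmod (c l))\<^sup>2)"
proof -
  let ?N = "real (card B)" and ?Q = "(*v) (matrix_inv R) ^^ n"
  define f where "f x = (cmod (\<Sum>l\<in>F. c l * e_fun l x))\<^sup>2" for x
  define K where "K = C\<^sup>2 * (\<Sum>l\<in>F. (cmod (c l))\<^sup>2)"
  have N: "?N > 0" using finite_B B_nonempty by (simp add: card_gt_0_iff)
  have f_meas: "f \<in> borel_measurable borel"
    unfolding f_def by measurable
  have f_le: "norm (f x) \<le> (\<Sum>l\<in>F. cmod (c l))\<^sup>2" for x
    unfolding f_def real_norm_def abs_power2
    by (intro power_mono order_trans[OF norm_sum] sum_mono) (auto simp: norm_mult)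
  have pointwise: "(1 / ?N ^ n) * (\<Sum>k\<in>words B n. f (tau_word R k x)) \<le> K" for x
  proof -
    have "(1 / ?N ^ n) * f (tau_word R k x)
        = (cmod (\<Sum>l\<in>F. cnj (A_entry R (card B) n l k) * (c l * e_fun l (?Q x))))\<^sup>2"
      if k: "k \<in> words B n" for k
    proof -
      have "length k = n" using k by (simp add: words_def)
      then have "e_fun l (tau_word R k x) = e_fun l (?Q x) * e_fun l (tau_word R k 0)" for l
        using tau_word_affine[of R k x] by (simp add: e_fun_add)
      then have "(\<Sum>l\<in>F. cnj (A_entry R (card B) n l k) * (c l * e_fun l (?Q x)))
          = (\<Sum>l\<in>F. c l * e_fun l (tau_word R k x)) / complex_of_real (sqrt (?N ^ n))"
        by (simp add: A_entry_conv sum_divide_distrib mult_ac)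
      then show ?thesis
        using N by (simp add: f_def norm_divide power_divide)
    qed
    then have "(1 / ?N ^ n) * (\<Sum>k\<in>words B n. f (tau_word R k x))
        = (\<Sum>k\<in>words B n. (cmod (\<Sum>l\<in>F. cnj (A_entry R (card B) n l k) * (c l * e_fun l (?Q x))))\<^sup>2)"
      by (simp add: sum_distrib_left)
    also have "\<dots> \<le> C\<^sup>2 * (\<Sum>l\<in>F. (cmod (c l * e_fun l (?Q x)))\<^sup>2)"
    proof (rule adjoint_matrix_bound)
      show "(\<Sum>l\<in>F. (cmod (\<Sum>k\<in>words B n. A_entry R (card B) n l k * a k))\<^sup>2)
          \<le> C\<^sup>2 * (\<Sum>k\<in>words B n. (cmod (a k))\<^sup>2)" for a
        using norm F C unfolding A_norm_def
        by (subst (asm) matrix_norm_le_iff) (auto simp: finite_words finite_B)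
    qed (use C in simp)
    also have "\<dots> = K" by (simp add: K_def norm_mult)
    finally show ?thesis .
  qed
  have int: "integrable M (\<lambda>x. f (tau_word R k x))" for k
    using f_le by (intro integrable_bounded_borel[where c = "(\<Sum>l\<in>F. cmod (c l))\<^sup>2"]
        measurable_compose[OF measurable_tau_word f_meas])
  have "(LINT x|M. f x) = (1 / ?N ^ n) * (\<Sum>k\<in>words B n. LINT x|M. f (tau_word R k x))"
    using integral_tau_word[OF f_meas f_le, of n] by simp
  also have "\<dots> = (LINT x|M. (1 / ?N ^ n) * (\<Sum>k\<in>words B n. f (tau_word R k x)))"
    using int by simp
  also have "\<dots> \<le> (LINT x|M. K)"
    using int by (intro integral_mono pointwise) auto
  also have "\<dots> = K" using prob_space by simp
  finally show ?thesis by (simp add: f_def K_def)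
qed

lemma Bessel_spectrum_if_A_norm_bounded:
  assumes r: "r > 0" and C: "C > 0" and norm: "\<And>n. A_norm R B L n r \<le> ennreal C"
  shows "Bessel_spectrum M L"
proof -
  have fin: "(\<Sum>l\<in>F. (cmod (L2_inner M v (e_fun l)))\<^sup>2) \<le> C\<^sup>2 * (L2_norm M v)\<^sup>2"
    if v: "square_integrable M v" and F: "finite F" "F \<subseteq> L" for v F
  proof -
    obtain n where n: "F \<subseteq> Lambda_n R L n r" using finite_subset_Lambda_n[OF F r] .
    have "(\<Sum>l\<in>F. (cmod (L2_inner M v (e_fun l)))\<^sup>2) \<le> C\<^sup>2 * (LINT x|M. (cmod (v x))\<^sup>2)"
      by (rule analysis_bound_if_synthesis_bound[OF _ _ _ synthesis_bound[OF C norm F(1) n] v])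
         (use C in \<open>auto simp: measurable_M_eq\<close>)
    then show ?thesis by (simp add: L2_norm_def)
  qed
  show ?thesis
    unfolding Bessel_spectrum_def Bessel_sequence_def
  proof (intro exI[of _ "C\<^sup>2"] conjI allI impI)
    fix v assume v: "square_integrable M v"
    show "(\<lambda>l. (cmod (L2_inner M v (e_fun l)))\<^sup>2) summable_on L"
      and "(\<Sum>\<^sub>\<infinity>l\<in>L. (cmod (L2_inner M v (e_fun l)))\<^sup>2) \<le> C\<^sup>2 * (L2_norm M v)\<^sup>2"
      using sum_bounds_imp_summable[OF _ fin[OF v], of L] by auto
  qed (use C in simp)
qed

end

section \<open>A Bessel spectrum gives bounded matrices\<close>
lemma sum_UN_le_sum:
  fixes f :: "'i \<Rightarrow> real"
  assumes "finite T" "\<And>t. t \<in> T \<Longrightarrow> finite (G t)" "\<And>i. 0 \<le> f i"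
  shows "sum f (\<Union>t\<in>T. G t) \<le> (\<Sum>t\<in>T. sum f (G t))"
  using assms(1,2)
proof (induction T)
  case (insert t T)
  have "sum f (G t \<union> (\<Union>t\<in>T. G t)) \<le> sum f (G t) + sum f (\<Union>t\<in>T. G t)"
    using insert sum_nonneg[of "G t \<inter> (\<Union>t\<in>T. G t)" f] assms(3)
    by (subst sum_Un) auto
  also have "\<dots> \<le> sum f (G t) + (\<Sum>t\<in>T. sum f (G t))"
    using insert by simp
  finally show ?case using insert by simp
qed simp

lemma funpow_inverse:
  fixes f g :: "'a \<Rightarrow> 'a"
  assumes "\<And>y. f (g y) = y"
  shows "(f ^^ n) ((g ^^ n) x) = x"
  by (induction n) (simp_all add: assms funpow_swap1[of f])

lemma matrix_power_diff:
  fixes A :: "real ^ 'd ^ 'd"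
  shows "((*v) A ^^ n) (x - y) = ((*v) A ^^ n) x - ((*v) A ^^ n) y"
  using matrix_power_add[of n A "x - y" y] by simp

lemma e_fun_diff_left: "e_fun (l - u) x = e_fun l x * cnj (e_fun u x)"
  by (simp add: e_fun_def exp_cnj inner_diff_left flip: exp_add) (simp add: algebra_simps)

lemma e_fun_cnj_mult [simp]: "e_fun l x * cnj (e_fun l x) = 1"
  using complex_norm_square[of "e_fun l x"] by simp

lemma inj_tau:
  assumes "invertible R"
  shows "inj (tau R b)"
proof (rule injI)
  fix x y assume "tau R b x = tau R b y"
  then have "R *v (matrix_inv R *v (x + b)) = R *v (matrix_inv R *v (y + b))"
    by (simp add: tau_def)
  then show "x = y"
    by (simp add: matrix_vector_mul_assoc matrix_inv_right[OF assms])
qed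

lemma inj_tau_word:
  assumes "invertible R"
  shows "inj (tau_word R k)"
proof (rule injI)
  fix x y assume "tau_word R k x = tau_word R k y"
  then show "x = y"
    by (induction k arbitrary: x y) (auto dest!: injD[OF inj_tau[OF assms]])
qed

context ifs_measure
begin

text \<open>
  By self-similarity the measure of a null set is the mean of the measures of its preimages.
\<close>
lemma AE_tau:
  assumes ae: "AE x in M. P x" and b: "b \<in> B"
  shows "AE x in M. P (tau R b x)"
proof -
  obtain S where S: "{x \<in> space M. \<not> P x} \<subseteq> S" "emeasure M S = 0" "S \<in> sets M"
    using AE_E[OF ae] by blast
  define f :: "real ^ 'd \<Rightarrow> real" where "f = indicator S"
  have f_meas: "f \<in> borel_measurable borel" using S(3) by (simp add: f_def)
  have f_bounds: "0 \<le> f x" "norm (f x) \<le> 1" for x by (auto simp: f_def indicator_def)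
  have f_tau_meas: "(\<lambda>x. f (tau R b x)) \<in> borel_measurable borel" for b
    by (rule measurable_compose[OF measurable_tau f_meas])
  have nonneg: "0 \<le> (LINT x|M. f (tau R b x))" for b
    using f_bounds by (intro Bochner_Integration.integral_nonneg) auto
  have "(LINT x|M. f x) = 0"
    using S(2,3) by (simp add: f_def measure_def)
  then have "(\<Sum>b\<in>B. LINT x|M. f (tau R b x)) = 0"
    using integral_tau[OF f_meas f_bounds(2)] finite_B B_nonempty by simp
  then have "(LINT x|M. f (tau R b x)) = 0"
    using b nonneg finite_B by (simp add: sum_nonneg_eq_0_iff)
  moreover have "integrable M (\<lambda>x. f (tau R b x))"
    using f_bounds(2) by (rule integrable_bounded_borel[OF f_tau_meas])
  ultimately have "AE x in M. f (tau R b x) = 0"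
    using integral_nonneg_eq_0_iff_AE[of M "\<lambda>x. f (tau R b x)"] f_bounds(1) by simp
  then show ?thesis
    by (rule AE_mp) (use S(1) in \<open>auto simp: f_def indicator_def\<close>)
qed

text \<open>
  The no-overlap condition passes from single letters to words.  The last letter of a word gives the
  outermost map.  If two words differ beyond the first letter, the claim at the lower level is
  pulled back along the first letter; if only the first letters differ, the common remaining map is
  injective and the condition for letters applies.
\<close>
lemma AE_tau_word_not_in_other_cylinder:
  assumes X: "attractor R B X" and no: "no_overlap R B X M"
    and "j \<in> words B n" "k \<in> words B n" "j \<noteq> k"
  shows "AE x in M. tau_word R j x \<notin> tau_word R k ` X"
  using assms(3-5)
proof (induction n arbitrary: j k)
  case (Suc n)
  obtain c j' where j: "j = c # j'" "c \<in> B" "j' \<in> words B n"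
    using Suc.prems(1) by (auto simp: words_Suc)
  obtain b k' where k: "k = b # k'" "b \<in> B" "k' \<in> words B n"
    using Suc.prems(2) by (auto simp: words_Suc)
  show ?case
  proof (cases "j' = k'")
    case False
    have "AE x in M. tau_word R j' x \<notin> tau_word R k' ` X"
      by (rule Suc.IH[OF j(3) k(3) False])
    then have "AE x in M. tau_word R j' (tau R c x) \<notin> tau_word R k' ` X"
      by (rule AE_tau[OF _ j(2)])
    then show ?thesis
    proof (rule eventually_mono)
      have "tau_word R k ` X \<subseteq> tau_word R k' ` X"
      using tau_word_attractor[OF X, of "[b]"] k(2) by (auto simp: k(1))
      then show "tau_word R j x \<notin> tau_word R k ` X"
        if "tau_word R j' (tau R c x) \<notin> tau_word R k' ` X" for x
        using that by (auto simp: j(1))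
    qed
  next
    case True
    then have cb: "c \<noteq> b" using Suc.prems(3) j(1) k(1) by simp
    have comp: "compact (tau R d ` X)" for d
      unfolding tau_eq_tau_word using X
      by (intro compact_continuous_image continuous_on_tau_word) (simp add: attractor_def)
    have "tau R c ` X \<inter> tau R b ` X \<in> sets M"
      using comp by (auto intro!: borel_compact)
    moreover have "emeasure M (tau R c ` X \<inter> tau R b ` X) = 0"
      using no j(2) k(2) cb by (auto simp: no_overlap_def)
    ultimately have "AE x in M. x \<notin> tau R c ` X \<inter> tau R b ` X"
      by (intro AE_not_in null_setsI)
    then have "AE x in M. tau R c x \<notin> tau R c ` X \<inter> tau R b ` X"
      by (rule AE_tau[OF _ j(2)])
    then show ?thesis
      using AE_attractor[OF X]
    proof eventually_elim
      case (elim x)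
      have "inj (tau_word R k')"
        by (intro inj_tau_word expansive_invertible expansive)
      then show ?case
        using elim by (auto simp: j(1) k(1) True dest: injD)
    qed
  qed
qed simp

text \<open>
  On the bounded attractor the phase \<open>2 * pi * (s \<bullet> x)\<close> is at most \<open>pi / 3\<close> in modulus for small
  \<open>s\<close>, so the real part of the integrand is at least \<open>cos (pi / 3) = 1 / 2\<close>.
\<close>
lemma fourier_transform_bounded_below:
  assumes X: "attractor R B X"
  obtains \<delta> where "\<delta> > 0" "\<And>s. norm s < \<delta> \<Longrightarrow> 1 / 2 \<le> cmod (LINT x|M. cnj (e_fun s x))"
proof -
  have "bounded X" using X by (simp add: attractor_def compact_imp_bounded)
  then obtain \<rho> where \<rho>: "\<rho> > 0" "\<And>x. x \<in> X \<Longrightarrow> norm x \<le> \<rho>"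
    unfolding bounded_pos by blast
  have "1 / 2 \<le> cmod (LINT x|M. cnj (e_fun s x))" if s: "norm s < 1 / (6 * \<rho>)" for s
  proof -
    have int: "integrable M (\<lambda>x. cnj (e_fun s x))"
      by (rule integrable_bounded_borel[where c = 1])
         (auto intro!: borel_measurable_continuous_onI continuous_intros)
    have "1 / 2 \<le> Re (cnj (e_fun s x))" if x: "x \<in> X" for x
    proof -
      have "\<bar>s \<bullet> x\<bar> \<le> norm s * norm x" by (rule Cauchy_Schwarz_ineq2)
      also have "\<dots> \<le> 1 / (6 * \<rho>) * \<rho>"
        using s \<rho> x by (intro mult_mono) auto
      also have "\<dots> = 1 / 6" using \<rho>(1) by simp
      finally have "2 * pi * \<bar>s \<bullet> x\<bar> \<le> 2 * pi * (1 / 6)"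
        by (intro mult_left_mono) auto
      then have "\<bar>2 * pi * (s \<bullet> x)\<bar> \<le> pi / 3" by (simp add: abs_mult)
      then have "cos (pi / 3) \<le> cos \<bar>2 * pi * (s \<bullet> x)\<bar>"
        by (intro cos_monotone_0_pi_le) auto
      then show ?thesis by (simp add: cos_60 e_fun_def Re_exp)
    qed
    then have "AE x in M. 1 / 2 \<le> Re (cnj (e_fun s x))"
      using AE_attractor[OF X] by auto
    then have "(LINT x|M. 1 / 2) \<le> (LINT x|M. Re (cnj (e_fun s x)))"
      using int by (intro integral_mono_AE integrable_Re) auto
    also have "\<dots> = Re (LINT x|M. cnj (e_fun s x))"
      using int by (rule integral_Re)
    also have "\<dots> \<le> cmod (LINT x|M. cnj (e_fun s x))" by (rule complex_Re_le_cmod)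
    finally show ?thesis using prob_space by simp
  qed
  then show thesis using that[of "1 / (6 * \<rho>)"] \<rho>(1) by simp
qed

text \<open>
  The test function for the coefficients \<open>a\<close>.  On the part of the cylinder of the word \<open>k\<close> that
  lies in no other cylinder of level \<open>n\<close> it equals \<open>a k\<close> times
  the exponential of frequency \<open>u\<close>, with the phase normalized to be 1 at \<open>tau_word R k 0\<close>.
  For \<open>u = 0\<close> it is a step function; other \<open>u\<close> move the frequencies that it detects.
\<close>
definition cylinder_wave ::
    "(real ^ 'd) set \<Rightarrow> nat \<Rightarrow> ((real ^ 'd) list \<Rightarrow> complex) \<Rightarrow> real ^ 'd \<Rightarrow> real ^ 'd \<Rightarrow> complex" where
  "cylinder_wave X n a u x =
     (\<Sum>k\<in>words B n. a k * cnj (e_fun u (tau_word R k 0)) * indicator (tau_word R k ` X) x) * e_fun u x"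

lemma measurable_cylinder_wave:
  assumes X: "attractor R B X"
  shows "cylinder_wave X n a u \<in> borel_measurable borel"
proof -
  have "tau_word R k ` X \<in> sets borel" for k
    using X by (intro borel_compact compact_continuous_image continuous_on_tau_word)
      (simp add: attractor_def)
  then show ?thesis
    unfolding cylinder_wave_def[abs_def]
    by (intro borel_measurable_times borel_measurable_sum measurable_e_fun
        borel_measurable_const borel_measurable_indicator)
qed

lemma cmod_cylinder_wave_le: "cmod (cylinder_wave X n a u x) \<le> (\<Sum>k\<in>words B n. cmod (a k))"
proof -
  have "cmod (cylinder_wave X n a u x)
      = cmod (\<Sum>k\<in>words B n. a k * cnj (e_fun u (tau_word R k 0)) * indicator (tau_word R k ` X) x)"
    by (simp add: cylinder_wave_def norm_mult)
  also have "\<dots> \<le> (\<Sum>k\<in>words B n. cmod (a k))"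
    by (intro order_trans[OF norm_sum] sum_mono) (simp add: norm_mult indicator_def)
  finally show ?thesis .
qed

lemma cylinder_wave_tau_word:
  assumes X: "attractor R B X" and no: "no_overlap R B X M" and j: "j \<in> words B n"
  shows "AE x in M. cylinder_wave X n a u (tau_word R j x)
           = a j * e_fun u (((*v) (matrix_inv R) ^^ n) x)"
proof -
  have "AE x in M. \<forall>k\<in>words B n - {j}. tau_word R j x \<notin> tau_word R k ` X"
    using AE_tau_word_not_in_other_cylinder[OF X no j]
    by (intro AE_finite_allI) (auto simp: finite_words finite_B)
  then show ?thesis
    using AE_attractor[OF X]
  proof eventually_elim
    case (elim x)
    let ?q = "((*v) (matrix_inv R) ^^ n) x"
    have "(\<Sum>k\<in>words B n. a k * cnj (e_fun u (tau_word R k 0)) * indicator (tau_word R k ` X) (tau_word R j x))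
        = (\<Sum>k\<in>{j}. a k * cnj (e_fun u (tau_word R k 0)) * indicator (tau_word R k ` X) (tau_word R j x))"
      using elim(1) j by (intro sum.mono_neutral_right) (auto simp: finite_words finite_B)
    also have "\<dots> = a j * cnj (e_fun u (tau_word R j 0))"
      using elim(2) by simp
    finally have "cylinder_wave X n a u (tau_word R j x)
        = a j * cnj (e_fun u (tau_word R j 0)) * e_fun u (tau_word R j x)"
      by (simp only: cylinder_wave_def)
    also have "e_fun u (tau_word R j x) = e_fun u (tau_word R j 0) * e_fun u ?q"
      using tau_word_affine[of R j x] j by (simp add: words_def e_fun_add)
    also have "a j * cnj (e_fun u (tau_word R j 0)) * (e_fun u (tau_word R j 0) * e_fun u ?q)
        = a j * (e_fun u (tau_word R j 0) * cnj (e_fun u (tau_word R j 0))) * e_fun u ?q"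
      by (simp only: mult_ac)
    finally show ?case by simp
  qed
qed

lemma norm_cylinder_wave:
  assumes X: "attractor R B X" and no: "no_overlap R B X M"
  shows "(LINT x|M. (cmod (cylinder_wave X n a u x))\<^sup>2)
    = (\<Sum>k\<in>words B n. (cmod (a k))\<^sup>2) / real (card B) ^ n"
proof -
  let ?v = "cylinder_wave X n a u"
  define f where "f x = (cmod (?v x))\<^sup>2" for x
  have f_meas: "f \<in> borel_measurable borel"
    unfolding f_def
    by (intro borel_measurable_power measurable_compose[OF measurable_cylinder_wave[OF X]] borel_measurable_norm)
  have f_le: "norm (f x) \<le> (\<Sum>k\<in>words B n. cmod (a k))\<^sup>2" for x
    unfolding f_def by (simp add: power_mono cmod_cylinder_wave_le)
  have "(LINT x|M. f (tau_word R k x)) = (cmod (a k))\<^sup>2" if k: "k \<in> words B n" for k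
  proof -
    have "(LINT x|M. f (tau_word R k x)) = (LINT x|M. (cmod (a k))\<^sup>2)"
    proof (rule integral_cong_AE)
      show "(\<lambda>x. f (tau_word R k x)) \<in> borel_measurable M"
        unfolding measurable_M_eq by (rule measurable_compose[OF measurable_tau_word f_meas])
      show "AE x in M. f (tau_word R k x) = (cmod (a k))\<^sup>2"
        using cylinder_wave_tau_word[OF X no k, of a u]
        by eventually_elim (simp add: f_def norm_mult)
    qed simp
    then show ?thesis using prob_space by simp
  qed
  then show ?thesis
    using integral_tau_word[OF f_meas f_le, of n] by (simp add: f_def)
qed

text \<open>
  The factorization that reads the matrix off the measure: up to the factor \<open>sqrt (card B ^ n)\<close>, the
  coefficients of the test function are the entries of \<open>A_n a\<close>, each multiplied by the Fourier transform of the measure at the rescaled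
  difference of the frequencies.
\<close>
lemma inner_cylinder_wave:
  assumes X: "attractor R B X" and no: "no_overlap R B X M"
  shows "L2_inner M (cylinder_wave X n a u) (e_fun l)
    = (\<Sum>k\<in>words B n. A_entry R (card B) n l k * a k) / complex_of_real (sqrt (real (card B) ^ n))
      * (LINT x|M. cnj (e_fun (((*v) (matrix_inv (transpose R)) ^^ n) (l - u)) x))"
proof -
  let ?v = "cylinder_wave X n a u" and ?Q = "(*v) (matrix_inv R) ^^ n"
  let ?s = "((*v) (matrix_inv (transpose R)) ^^ n) (l - u)" and ?N = "real (card B)"
  define f where "f x = ?v x * cnj (e_fun l x)" for x
  define m where "m = (LINT x|M. cnj (e_fun ?s x))"
  have f_meas: "f \<in> borel_measurable borel"
    unfolding f_def
    by (intro borel_measurable_times measurable_cylinder_wave[OF X]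
        borel_measurable_continuous_onI continuous_on_cnj continuous_on_e_fun)
  have f_le: "norm (f x) \<le> (\<Sum>k\<in>words B n. cmod (a k))" for x
    using cmod_cylinder_wave_le by (simp add: f_def norm_mult)
  have shift: "e_fun ?s x = e_fun l (?Q x) * cnj (e_fun u (?Q x))" for x
  proof -
    have "?s \<bullet> x = (l - u) \<bullet> ?Q x"
      by (simp add: matrix_inv_transpose[OF expansive_invertible[OF expansive]]
          matrix_power_transpose_inner)
    then have "e_fun ?s x = e_fun (l - u) (?Q x)" by (simp add: e_fun_def)
    then show ?thesis by (simp add: e_fun_diff_left)
  qed
  have piece: "(LINT x|M. f (tau_word R k x)) = a k * cnj (e_fun l (tau_word R k 0)) * m"
    if k: "k \<in> words B n" for k
  proof -
    have "(LINT x|M. f (tau_word R k x))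
        = (LINT x|M. a k * cnj (e_fun l (tau_word R k 0)) * cnj (e_fun ?s x))"
    proof (rule integral_cong_AE)
      show "(\<lambda>x. f (tau_word R k x)) \<in> borel_measurable M"
        unfolding measurable_M_eq by (rule measurable_compose[OF measurable_tau_word f_meas])
      show "(\<lambda>x. a k * cnj (e_fun l (tau_word R k 0)) * cnj (e_fun ?s x)) \<in> borel_measurable M"
        unfolding measurable_M_eq
        by (intro borel_measurable_continuous_onI continuous_intros)
      show "AE x in M. f (tau_word R k x) = a k * cnj (e_fun l (tau_word R k 0)) * cnj (e_fun ?s x)"
        using cylinder_wave_tau_word[OF X no k, of a u]
      proof eventually_elim
        case (elim x)
        have "tau_word R k x = ?Q x + tau_word R k 0"
          using tau_word_affine[of R k x] k by (simp add: words_def)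
        then have "e_fun l (tau_word R k x) = e_fun l (?Q x) * e_fun l (tau_word R k 0)"
          by (simp add: e_fun_add)
        then show ?case using elim by (simp add: f_def shift mult_ac)
      qed
    qed
    then show ?thesis by (simp add: m_def)
  qed
  have sq: "complex_of_real (?N ^ n) = complex_of_real (sqrt (?N ^ n)) * complex_of_real (sqrt (?N ^ n))"
    by (simp only: flip: of_real_mult) simp
  have "L2_inner M ?v (e_fun l) = (\<Sum>k\<in>words B n. a k * cnj (e_fun l (tau_word R k 0)) * m) / complex_of_real (?N ^ n)"
    using integral_tau_word[OF f_meas f_le, of n] piece
    by (simp add: L2_inner_def f_def scaleR_conv_of_real)
  also have "\<dots> = (\<Sum>k\<in>words B n. A_entry R (card B) n l k * a k) / complex_of_real (sqrt (?N ^ n)) * m"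
  proof -
    have "(\<Sum>k\<in>words B n. A_entry R (card B) n l k * a k)
        = (\<Sum>k\<in>words B n. a k * cnj (e_fun l (tau_word R k 0))) / complex_of_real (sqrt (?N ^ n))"
      by (simp add: A_entry_conv sum_divide_distrib mult_ac)
    then show ?thesis unfolding sq by (simp flip: sum_distrib_right)
  qed
  finally show ?thesis by (simp add: m_def)
qed

text \<open>
  Where the Fourier transform is at least \<open>1 / 2\<close>, the coefficients of the test function control the
  entries of \<open>A_n a\<close>; the factors \<open>card B ^ n\<close> in the coefficients and in the norm of the test
  function cancel, so that the bound is the same for all \<open>n\<close>.
\<close>
lemma local_matrix_bound:
  assumes X: "attractor R B X" and no: "no_overlap R B X M"
    and bessel: "\<And>v. square_integrable M v \<Longrightarrow>
          (\<Sum>l\<in>G. (cmod (L2_inner M v (e_fun l)))\<^sup>2) \<le> K * (LINT x|M. (cmod (v x))\<^sup>2)"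
    and below: "\<And>l. l \<in> G \<Longrightarrow>
          1 / 2 \<le> cmod (LINT x|M. cnj (e_fun (((*v) (matrix_inv (transpose R)) ^^ n) (l - u)) x))"
  shows "(\<Sum>l\<in>G. (cmod (\<Sum>k\<in>words B n. A_entry R (card B) n l k * a k))\<^sup>2)
    \<le> 4 * K * (\<Sum>k\<in>words B n. (cmod (a k))\<^sup>2)"
proof -
  let ?v = "cylinder_wave X n a u" and ?N = "real (card B) ^ n"
  let ?s = "\<lambda>l. ((*v) (matrix_inv (transpose R)) ^^ n) (l - u)"
  let ?y = "\<lambda>l. \<Sum>k\<in>words B n. A_entry R (card B) n l k * a k"
  have N: "?N > 0" using finite_B B_nonempty by (simp add: card_gt_0_iff)
  have sq: "square_integrable M ?v"
    unfolding square_integrable_def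
  proof
    show v: "?v \<in> borel_measurable M"
      unfolding measurable_M_eq by (rule measurable_cylinder_wave[OF X])
    show "integrable M (\<lambda>x. (cmod (?v x))\<^sup>2)"
      using v by (intro integrable_const_bound[of _ "(\<Sum>k\<in>words B n. cmod (a k))\<^sup>2"])
        (auto intro!: power_mono cmod_cylinder_wave_le)
  qed
  have "(cmod (?y l))\<^sup>2 / (4 * ?N) \<le> (cmod (L2_inner M ?v (e_fun l)))\<^sup>2" if l: "l \<in> G" for l
  proof -
    have "(1 / 2)\<^sup>2 \<le> (cmod (LINT x|M. cnj (e_fun (?s l) x)))\<^sup>2"
      using below[OF l] by (intro power_mono) auto
    then have "(cmod (?y l))\<^sup>2 / ?N * (1 / 2)\<^sup>2
        \<le> (cmod (?y l))\<^sup>2 / ?N * (cmod (LINT x|M. cnj (e_fun (?s l) x)))\<^sup>2"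
      using N by (intro mult_left_mono) auto
    also have "\<dots> = (cmod (L2_inner M ?v (e_fun l)))\<^sup>2"
      using N unfolding inner_cylinder_wave[OF X no]
      by (simp add: norm_mult norm_divide power_mult_distrib power_divide)
    finally show ?thesis by (simp add: power2_eq_square)
  qed
  then have "(\<Sum>l\<in>G. (cmod (?y l))\<^sup>2 / (4 * ?N)) \<le> (\<Sum>l\<in>G. (cmod (L2_inner M ?v (e_fun l)))\<^sup>2)"
    by (rule sum_mono)
  also have "\<dots> \<le> K * ((\<Sum>k\<in>words B n. (cmod (a k))\<^sup>2) / ?N)"
    using bessel[OF sq] by (simp only: norm_cylinder_wave[OF X no])
  finally show ?thesis
    using N by (simp add: field_simps flip: sum_divide_distrib)
qed

text \<open>
  The rescaled frequencies lie in the ball of radius \<open>r\<close>.  Cover it by finitely many balls of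
  radius \<open>\<delta>\<close>, such that the Fourier transform is at least \<open>1 / 2\<close> within distance \<open>\<delta>\<close> of 0.  Each ball is handled by test
  functions whose frequency \<open>u\<close> is rescaled to its centre \<open>t\<close>.  The number of balls depends only on
  \<open>r\<close> and \<open>\<delta>\<close>, not on \<open>n\<close>.
\<close>
lemma A_norm_bounded_if_Bessel_spectrum:
  assumes X: "attractor R B X" and no: "no_overlap R B X M"
    and Bessel: "Bessel_spectrum M L" and r: "r > 0"
  shows "\<exists>C>0. \<forall>n. A_norm R B L n r \<le> ennreal C"
proof -
  obtain K where K: "K > 0" and
    bessel: "\<And>v. square_integrable M v \<Longrightarrow>
        (\<lambda>l. (cmod (L2_inner M v (e_fun l)))\<^sup>2) summable_on L \<and>
        (\<Sum>\<^sub>\<infinity>l\<in>L. (cmod (L2_inner M v (e_fun l)))\<^sup>2) \<le> K * (L2_norm M v)\<^sup>2"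
    using Bessel by (auto simp: Bessel_spectrum_def Bessel_sequence_def)
  have bessel_fin: "(\<Sum>l\<in>G. (cmod (L2_inner M v (e_fun l)))\<^sup>2) \<le> K * (LINT x|M. (cmod (v x))\<^sup>2)"
    if v: "square_integrable M v" and G: "finite G" "G \<subseteq> L" for v G
  proof -
    have "(\<Sum>l\<in>G. (cmod (L2_inner M v (e_fun l)))\<^sup>2)
        \<le> (\<Sum>\<^sub>\<infinity>l\<in>L. (cmod (L2_inner M v (e_fun l)))\<^sup>2)"
      using bessel[OF v] G by (intro finite_sum_le_infsum) auto
    also have "\<dots> \<le> K * (L2_norm M v)\<^sup>2" using bessel[OF v] by simp
    finally show ?thesis by (simp add: L2_norm_def)
  qed
  obtain \<delta> where \<delta>: "\<delta> > 0"
    "\<And>s. norm s < \<delta> \<Longrightarrow> 1 / 2 \<le> cmod (LINT x|M. cnj (e_fun s x))"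
    using fourier_transform_bounded_below[OF X] by metis
  have "seq_compact (cball (0 :: real ^ 'd) r)" by (simp add: compact_imp_seq_compact)
  then obtain T where T: "finite T" "cball (0 :: real ^ 'd) r \<subseteq> (\<Union>t\<in>T. ball t \<delta>)"
    using seq_compact_imp_totally_bounded \<delta>(1) by metis
  \<comment> \<open>The summand 1 makes the constant positive whatever the cover is.\<close>
  define C where "C = sqrt (4 * K * (card T + 1))"
  have C: "C > 0" using K by (simp add: C_def)
  have "A_norm R B L n r \<le> ennreal C" for n
    unfolding A_norm_def
  proof (subst matrix_norm_le_iff)
    let ?S = "(*v) (transpose R)" and ?P = "(*v) (matrix_inv (transpose R))"
    let ?y = "\<lambda>a l. (cmod (\<Sum>k\<in>words B n. A_entry R (card B) n l k * a k))\<^sup>2"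
    have inv: "(?P ^^ n) ((?S ^^ n) t) = t" for t
    proof (rule funpow_inverse)
      have "invertible (transpose R)"
        using expansive_invertible[OF expansive] by (rule transpose_invertible)
      then show "?P (?S y) = y" for y
        by (simp only: matrix_vector_mul_assoc matrix_inv_left matrix_vector_mul_lid)
    qed
    show "\<forall>a F. finite F \<longrightarrow> F \<subseteq> Lambda_n R L n r \<longrightarrow>
        (\<Sum>l\<in>F. ?y a l) \<le> C\<^sup>2 * (\<Sum>k\<in>words B n. (cmod (a k))\<^sup>2)"
    proof (intro allI impI)
      fix a :: "(real ^ 'd) list \<Rightarrow> complex" and F
      assume F: "finite F" "F \<subseteq> Lambda_n R L n r"
      define s where "s = (\<Sum>k\<in>words B n. (cmod (a k))\<^sup>2)"
      have s: "s \<ge> 0" unfolding s_def by (intro sum_nonneg) auto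
      define G where "G t = {l \<in> F. (?P ^^ n) l \<in> ball t \<delta>}" for t
      have G_bound: "(\<Sum>l\<in>G t. ?y a l) \<le> 4 * K * s" for t
        unfolding s_def
      proof (rule local_matrix_bound[OF X no, where u = "(?S ^^ n) t"])
        fix v assume "square_integrable M v"
        moreover have "finite (G t)" "G t \<subseteq> L" using F by (auto simp: G_def Lambda_n_def)
        ultimately show "(\<Sum>l\<in>G t. (cmod (L2_inner M v (e_fun l)))\<^sup>2)
            \<le> K * (LINT x|M. (cmod (v x))\<^sup>2)"
          by (rule bessel_fin)
      next
        fix l assume "l \<in> G t"
        then show "1 / 2 \<le> cmod (LINT x|M. cnj (e_fun ((?P ^^ n) (l - (?S ^^ n) t)) x))"
          by (intro \<delta>(2)) (simp add: G_def matrix_power_diff inv dist_norm norm_minus_commute)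
      qed
      have "F \<subseteq> (\<Union>t\<in>T. G t)"
        using F(2) T(2) by (fastforce simp: G_def Lambda_n_def)
      then have "(\<Sum>l\<in>F. ?y a l) \<le> (\<Sum>l\<in>(\<Union>t\<in>T. G t). ?y a l)"
        using F(1) T(1) by (intro sum_mono2) (auto simp: G_def)
      also have "\<dots> \<le> (\<Sum>t\<in>T. \<Sum>l\<in>G t. ?y a l)"
        using F(1) T(1) by (intro sum_UN_le_sum) (auto simp: G_def)
      also have "\<dots> \<le> (\<Sum>t\<in>T. 4 * K * s)" by (intro sum_mono G_bound)
      also have "\<dots> \<le> C\<^sup>2 * s"
        using K s by (simp add: C_def algebra_simps)
      finally show "(\<Sum>l\<in>F. ?y a l) \<le> C\<^sup>2 * (\<Sum>k\<in>words B n. (cmod (a k))\<^sup>2)"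
        by (simp only: s_def)
    qed
  qed (use C in \<open>simp_all add: finite_words finite_B\<close>)
  then show ?thesis using C by blast
qed

end

section \<open>The equivalence\<close>
theorem theorem3p4:
  fixes R :: "real ^ 'd ^ 'd" and B :: "(real ^ 'd) set" and N :: nat
    and X :: "(real ^ 'd) set" and M :: "(real ^ 'd) measure" and L :: "(real ^ 'd) set"
  assumes "integer_matrix R" and "expansive R"
    and "\<And>b. b \<in> B \<Longrightarrow> integer_vector b" and "card B = N" and "N \<ge> 2"
    and "invariant_measure R B M"
    and "attractor R B X"
    and "no_overlap R B X M"
    and "topological_space_class.discrete L"
  shows "(Bessel_spectrum M L \<longleftrightarrow>
            (\<exists>r0>0. \<exists>C>0. \<forall>n. A_norm R B L n r0 \<le> ennreal C)) \<and>
         (Bessel_spectrum M L \<longleftrightarrow>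
            (\<forall>r0>0. \<exists>C>0. \<forall>n. A_norm R B L n r0 \<le> ennreal C))"
proof -
  have "card B \<ge> 2" using assms(4,5) by simp
  then have "finite B" "B \<noteq> {}"
    by (auto intro: card_ge_0_finite)
  then interpret ifs_measure R B M
    using assms(2,6) by unfold_locales
  have all: "\<forall>r0>0. \<exists>C>0. \<forall>n. A_norm R B L n r0 \<le> ennreal C" if "Bessel_spectrum M L"
    using A_norm_bounded_if_Bessel_spectrum[OF assms(7,8) that] by blast
  have "Bessel_spectrum M L" if "\<exists>r0>0. \<exists>C>0. \<forall>n. A_norm R B L n r0 \<le> ennreal C"
    using that Bessel_spectrum_if_A_norm_bounded by blast
  with all show ?thesis by (metis zero_less_one)
qed

end
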